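(* For every fixed graph $H$ with at least two edges, the threshold bias of the $(1:q)$ Budget $H$-Game on $K_n$ satisfies $q_H^b(n)=\Theta\big(n^{1/m(H)}\big)$ as $n\to\infty$.
   Context: For a graph $H$ with at least two edges, let $v(\cdot)$ and $e(\cdot)$ denote the numbers of vertices and edges, and let $$m(H):=\max_{\substack{H'\subseteq H\\ v(H')\ge 3}}\frac{e(H')-1}{v(H')-2},$$ the maximum being over subgraphs $H'$ of $H$ with at least three vertices. The $(1:q)$ Budget $H$-Game on the complete graph $K_n$ is played by Maker and Breaker, who take alternate turns, with Maker beginning. In her turn, Maker claims one previously unclaimed edge of $K_n$. In his turn, Breaker may claim an arbitrary number (possibly zero) of previously unclaimed edges of $K_n$, subject to the condition that at the end of his turn the total number of edges claimed by Breaker so far is at most $q$ times the total number of edges claimed by Maker so far. Maker wins if at some point she has claimed all edges of a subgraph of $K_n$ isomorphic to $H$. Breaker wins if he manages to claim at least one edge of each such subgraph. The threshold bias $q_H^b(n)$ is the smallest non-negative integer $q$ such that Breaker has a winning strategy in this game. *)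

theory Defs
  imports "HOL-Analysis.Analysis" "HOL-Library.Landau_Symbols" "HOL-Library.Ramsey"
begin

definition simple_graph :: "'a set \<Rightarrow> 'a set set \<Rightarrow> bool" where
  "simple_graph V E \<longleftrightarrow> finite V \<and> E \<subseteq> [V]\<^bsup>2\<^esup>"

definition is_subgraph :: "'a set \<Rightarrow> 'a set set \<Rightarrow> 'a set \<Rightarrow> 'a set set \<Rightarrow> bool" where
  "is_subgraph V' E' V E \<longleftrightarrow> simple_graph V' E' \<and> V' \<subseteq> V \<and> E' \<subseteq> E"

definition graph_isomorphic :: "'a set \<Rightarrow> 'a set set \<Rightarrow> 'b set \<Rightarrow> 'b set set \<Rightarrow> bool" where
  "graph_isomorphic V E V' E' \<longleftrightarrow> (\<exists>f. bij_betw f V V' \<and> (\<lambda>e. f ` e) ` E = E')"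

(* The subtractions are in the reals: a subgraph without edges contributes a negative value. *)
definition max_density :: "'a set \<Rightarrow> 'a set set \<Rightarrow> real" where
  "max_density V E =
     Max {(real (card E') - 1) / (real (card V') - 2) | V' E'.
            is_subgraph V' E' V E \<and> card V' \<ge> 3}"

definition K_verts :: "nat \<Rightarrow> nat set" where
  "K_verts n = {..<n}"

definition K_edges :: "nat \<Rightarrow> nat set set" where
  "K_edges n = [K_verts n]\<^bsup>2\<^esup>"

(* Edge sets of the subgraphs of K_n that are isomorphic to (V, E). *)
definition copies :: "'a set \<Rightarrow> 'a set set \<Rightarrow> nat \<Rightarrow> nat set set set" where
  "copies V E n = {E'. \<exists>V'. is_subgraph V' E' (K_verts n) (K_edges n) \<and>
                            graph_isomorphic V E V' E'}"

(* A history lists the completed rounds in chronological order; a round is the edge claimed by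
   Maker together with the set of edges with which Breaker answers. *)
type_synonym history = "(nat set \<times> nat set set) list"

definition maker_edges :: "history \<Rightarrow> nat set set" where
  "maker_edges h = fst ` set h"

definition breaker_edges :: "history \<Rightarrow> nat set set" where
  "breaker_edges h = \<Union> (snd ` set h)"

definition free_edges :: "nat \<Rightarrow> history \<Rightarrow> nat set set" where
  "free_edges n h = K_edges n - (maker_edges h \<union> breaker_edges h)"

(* Breaker chooses his answer knowing the completed rounds and the edge Maker has just claimed. *)
type_synonym strategy = "history \<Rightarrow> nat set \<Rightarrow> nat set set"

definition legal_answer :: "nat \<Rightarrow> nat \<Rightarrow> history \<Rightarrow> nat set \<Rightarrow> nat set set \<Rightarrow> bool" where
  "legal_answer n q h e S \<longleftrightarrow>
     S \<subseteq> free_edges n h - {e} \<and>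
     card (breaker_edges h \<union> S) \<le> q * card (maker_edges h \<union> {e})"

(* The histories that can arise when Breaker follows the strategy and Maker plays arbitrarily. *)
inductive consistent_history :: "nat \<Rightarrow> strategy \<Rightarrow> history \<Rightarrow> bool" for n \<sigma> where
  start: "consistent_history n \<sigma> []"
| round: "consistent_history n \<sigma> h \<Longrightarrow> e \<in> free_edges n h \<Longrightarrow>
          consistent_history n \<sigma> (h @ [(e, \<sigma> h e)])"

definition legal_strategy :: "nat \<Rightarrow> nat \<Rightarrow> strategy \<Rightarrow> bool" where
  "legal_strategy n q \<sigma> \<longleftrightarrow>
     (\<forall>h e. consistent_history n \<sigma> h \<and> e \<in> free_edges n h \<longrightarrow> legal_answer n q h e (\<sigma> h e))"

(* The game is played until no edge is left for Maker. Since Maker's edges stay disjoint from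
   Breaker's, Breaker's edges meet every copy at the end of a play if and only if Maker has not
   claimed a whole copy at any point of it. *)
definition breaker_wins_play :: "'a set \<Rightarrow> 'a set set \<Rightarrow> nat \<Rightarrow> history \<Rightarrow> bool" where
  "breaker_wins_play V E n h \<longleftrightarrow> (\<forall>C \<in> copies V E n. C \<inter> breaker_edges h \<noteq> {})"

definition breaker_winning_strategy ::
    "'a set \<Rightarrow> 'a set set \<Rightarrow> nat \<Rightarrow> nat \<Rightarrow> strategy \<Rightarrow> bool" where
  "breaker_winning_strategy V E n q \<sigma> \<longleftrightarrow>
     legal_strategy n q \<sigma> \<and>
     (\<forall>h. consistent_history n \<sigma> h \<and> free_edges n h = {} \<longrightarrow> breaker_wins_play V E n h)"

(* If E has at least two edges, Breaker wins with q = n choose 2 by claiming everything in his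
   first turn, so the minimum is over a nonempty set. *)
definition threshold_bias :: "'a set \<Rightarrow> 'a set set \<Rightarrow> nat \<Rightarrow> nat" where
  "threshold_bias V E n = (LEAST q. \<exists>\<sigma>. breaker_winning_strategy V E n q \<sigma>)"

end

theory Submission
  imports Defs
begin

text \<open>Upper bound: fix a densest subgraph H' of H, with k edges, and p of order n powr (- (1 / m)).
  Weigh every copy of H' through f that Breaker has not hit by p to the number of its edges other
  than f that Maker still lacks; the threat of f is the total weight. Initially all threats are
  small, an edge completing a copy has threat at least 1, and one edge of Maker raises the sum of
  all threats by O(1 / p). Hence Breaker can claim every edge as soon as its threat reaches 1/2 and
  stay within a budget of O(1 / p) edges per edge of Maker: here the budget rule replaces the
  analysis needed when he may not save up edges.

  Lower bound: Maker plays L uniformly random edges, with L of order n powr (2 - 1 / m). Breaker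
  ends up with at most q L edges, so only a small fraction of her L attempts fails. The random
  sequence contains many copies of H, and by a second moment computation, whose overlap terms are
  controlled by m, these are spread so evenly that the failed attempts cannot spoil all of them.
  Only expectations (sums over all sequences) are needed.\<close>

subsection \<open>Copies and densities\<close>

lemma finite_K_edges [simp]: "finite (K_edges n)"
  unfolding K_edges_def K_verts_def by (simp add: finite_imp_finite_nsets)

lemma card_K_edges: "card (K_edges n) = n choose 2"
  unfolding K_edges_def K_verts_def by simp

lemma finite_graph_edges: "simple_graph V E \<Longrightarrow> finite E"
  unfolding simple_graph_def by (meson finite_imp_finite_nsets finite_subset)

lemma card_graph_edge: "simple_graph V E \<Longrightarrow> e \<in> E \<Longrightarrow> card e = 2"
  unfolding simple_graph_def nsets_def by auto

lemma graph_edge_subset: "simple_graph V E \<Longrightarrow> e \<in> E \<Longrightarrow> e \<subseteq> V"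
  unfolding simple_graph_def nsets_def by auto

lemma inj_on_image_edges:
  assumes "simple_graph V E" "inj_on \<phi> V"
  shows "inj_on ((`) \<phi>) E"
  using assms by (meson graph_edge_subset inj_on_image_eq_iff inj_onI)

lemma image_graph_subset_K_edges:
  assumes "simple_graph V E" "inj_on \<phi> V" "\<phi> ` V \<subseteq> {..<n}"
  shows "(`) \<phi> ` E \<subseteq> K_edges n"
proof
  fix x assume "x \<in> (`) \<phi> ` E"
  then obtain e where e: "e \<in> E" "x = \<phi> ` e" by auto
  have "card x = 2" "e \<subseteq> V"
    using e assms card_graph_edge graph_edge_subset by (metis card_image inj_on_subset)+
  then show "x \<in> K_edges n"
    using assms e unfolding K_edges_def K_verts_def nsets_def
    by (auto intro: card_ge_0_finite)
qed

text \<open>Restricting an isomorphism to \<open>V\<close> makes it extensional, so copies are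
  parametrized by members of a \<open>PiE\<close> set and can be counted. Several maps may give the
  same copy.\<close>

lemma copies_eq:
  assumes "simple_graph V E"
  shows "copies V E n = {(`) \<phi> ` E | \<phi>. \<phi> \<in> V \<rightarrow>\<^sub>E {..<n} \<and> inj_on \<phi> V}"
proof (intro equalityI subsetI)
  fix C assume "C \<in> copies V E n"
  then obtain V' f where f: "V' \<subseteq> {..<n}" "bij_betw f V V'" "(`) f ` E = C"
    unfolding copies_def is_subgraph_def graph_isomorphic_def K_verts_def by auto
  have "(`) (restrict f V) ` E = C"
    unfolding f(3)[symmetric] using graph_edge_subset[OF assms]
    by (intro image_cong refl) auto
  moreover have "restrict f V \<in> V \<rightarrow>\<^sub>E {..<n}" "inj_on (restrict f V) V"
    using f by (auto simp: bij_betw_def inj_on_def)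
  ultimately show "C \<in> {(`) \<phi> ` E | \<phi>. \<phi> \<in> V \<rightarrow>\<^sub>E {..<n} \<and> inj_on \<phi> V}" by blast
next
  fix C assume "C \<in> {(`) \<phi> ` E | \<phi>. \<phi> \<in> V \<rightarrow>\<^sub>E {..<n} \<and> inj_on \<phi> V}"
  then obtain \<phi> where \<phi>: "\<phi> \<in> V \<rightarrow>\<^sub>E {..<n}" "inj_on \<phi> V" "C = (`) \<phi> ` E" by auto
  have sub: "\<phi> ` V \<subseteq> {..<n}" using \<phi>(1) by auto
  have CK: "C \<subseteq> K_edges n"
    using image_graph_subset_K_edges[OF assms \<phi>(2) sub] \<phi>(3) by simp
  have "C \<subseteq> [\<phi> ` V]\<^bsup>2\<^esup>"
    using CK graph_edge_subset[OF assms] \<phi>(3) unfolding K_edges_def nsets_def by blast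
  moreover have "finite V" using assms by (simp add: simple_graph_def)
  ultimately have "is_subgraph (\<phi> ` V) C (K_verts n) (K_edges n)"
    using CK sub unfolding is_subgraph_def simple_graph_def K_verts_def by auto
  moreover have "graph_isomorphic V E (\<phi> ` V) C"
    unfolding graph_isomorphic_def using \<phi>(2,3) by (auto simp: bij_betw_def)
  ultimately show "C \<in> copies V E n" unfolding copies_def by blast
qed

lemma copy_edges:
  assumes "simple_graph V E" "C \<in> copies V E n"
  shows "C \<subseteq> K_edges n" "card C = card E"
proof -
  obtain \<phi> where \<phi>: "\<phi> \<in> V \<rightarrow>\<^sub>E {..<n}" "inj_on \<phi> V" "C = (`) \<phi> ` E"
    using assms(2) unfolding copies_eq[OF assms(1)] by blast
  then show "C \<subseteq> K_edges n"
    using image_graph_subset_K_edges[OF assms(1) \<phi>(2)] by (simp add: PiE_iff image_subset_iff)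
  show "card C = card E"
    using \<phi>(2,3) card_image[OF inj_on_image_edges[OF assms(1)]] by simp
qed

text \<open>This allows Breaker to aim only at a densest subgraph: a set that meets every copy of it
  meets every copy of the whole graph.\<close>

lemma copy_contains_subgraph_copy:
  assumes "is_subgraph V' E' V E" "simple_graph V E" "C \<in> copies V E n"
  obtains C' where "C' \<in> copies V' E' n" "C' \<subseteq> C"
proof -
  obtain \<phi> where \<phi>: "\<phi> \<in> V \<rightarrow>\<^sub>E {..<n}" "inj_on \<phi> V" "C = (`) \<phi> ` E"
    using assms(3) unfolding copies_eq[OF assms(2)] by blast
  have s: "simple_graph V' E'" "V' \<subseteq> V" "E' \<subseteq> E" using assms by (auto simp: is_subgraph_def)
  have "restrict \<phi> V' \<in> V' \<rightarrow>\<^sub>E {..<n}" "inj_on (restrict \<phi> V') V'"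
    using \<phi> s by (auto simp: inj_on_def)
  then have "(`) (restrict \<phi> V') ` E' \<in> copies V' E' n"
    unfolding copies_eq[OF s(1)] by blast
  moreover have "(`) (restrict \<phi> V') ` E' = (`) \<phi> ` E'"
    using graph_edge_subset[OF s(1)] by (intro image_cong refl) auto
  ultimately show ?thesis using that \<phi>(3) s(3) by (metis image_mono)
qed

text \<open>The values at distinct points are chosen independently, with only
  \<open>T \<inter> A\<close> available on \<open>W\<close>. The bound serves both for copies
  through a given edge and for pairs of overlapping embeddings.\<close>

lemma card_PiE_confined:
  assumes "finite V" "W \<subseteq> V"
  shows "card {\<phi> \<in> V \<rightarrow>\<^sub>E A. \<phi> ` W \<subseteq> T} \<le> card (T \<inter> A) ^ card W * card A ^ (card V - card W)"
proof -
  have "{\<phi> \<in> V \<rightarrow>\<^sub>E A. \<phi> ` W \<subseteq> T} = PiE V (\<lambda>x. if x \<in> W then T \<inter> A else A)"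
    (is "?L = ?R")
  proof (intro equalityI subsetI)
    fix \<phi> assume "\<phi> \<in> ?R"
    then have \<phi>: "\<phi> x \<in> (if x \<in> W then T \<inter> A else A)" "\<phi> \<in> extensional V" if "x \<in> V" for x
      using that by (auto simp: PiE_iff)
    then have "\<phi> x \<in> A" if "x \<in> V" for x using that by (metis IntD2)
    moreover have "\<phi> x \<in> T" if "x \<in> W" for x using that \<phi>(1)[of x] assms(2) by auto
    ultimately show "\<phi> \<in> ?L" using \<open>\<phi> \<in> ?R\<close> by (auto simp: PiE_iff)
  qed (auto simp: PiE_iff)
  also have "card \<dots> = (\<Prod>x\<in>V. if x \<in> W then card (T \<inter> A) else card A)"
    using assms by (simp add: card_PiE if_distrib cong: if_cong)
  also have "\<dots> = card (T \<inter> A) ^ card W * card A ^ (card V - card W)"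
    using assms by (simp add: prod.If_cases Int_absorb1 card_Diff_subset finite_subset flip: Diff_eq)
  finally show ?thesis by simp
qed

text \<open>Some edge \<open>e\<close> of the graph is mapped onto \<open>f\<close>. Each end of
  \<open>e\<close> then has at most two possible images, which gives the factor 4, and every other
  vertex has at most \<open>n\<close>.\<close>

lemma card_copies_through_edge:
  assumes "simple_graph V E" "card f = 2"
  shows "card {C \<in> copies V E n. f \<in> C} \<le> card E * 4 * n ^ (card V - 2)"
proof -
  have finV: "finite V" using assms by (simp add: simple_graph_def)
  let ?\<Phi> = "\<lambda>e. {\<phi> \<in> V \<rightarrow>\<^sub>E {..<n}. \<phi> ` e \<subseteq> f}"
  have fin: "finite (?\<Phi> e)" for e
    using finV by (simp add: finite_PiE)
  have "{C \<in> copies V E n. f \<in> C} \<subseteq> (\<Union>e\<in>E. (\<lambda>\<phi>. (`) \<phi> ` E) ` ?\<Phi> e)"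
    unfolding copies_eq[OF assms(1)] by blast
  then have "card {C \<in> copies V E n. f \<in> C} \<le> card (\<Union>e\<in>E. (\<lambda>\<phi>. (`) \<phi> ` E) ` ?\<Phi> e)"
    by (intro card_mono) (auto simp: finite_graph_edges[OF assms(1)] fin)
  also have "\<dots> \<le> (\<Sum>e\<in>E. card ((\<lambda>\<phi>. (`) \<phi> ` E) ` ?\<Phi> e))"
    by (intro card_UN_le finite_graph_edges[OF assms(1)])
  also have "\<dots> \<le> (\<Sum>e\<in>E. 4 * n ^ (card V - 2))"
  proof (rule sum_mono)
    fix e assume e: "e \<in> E"
    have "card ((\<lambda>\<phi>. (`) \<phi> ` E) ` ?\<Phi> e) \<le> card (?\<Phi> e)" by (intro card_image_le fin)
    also have "\<dots> \<le> card (f \<inter> {..<n}) ^ card e * card {..<n} ^ (card V - card e)"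
      by (intro card_PiE_confined finV graph_edge_subset[OF assms(1) e])
    also have "\<dots> \<le> 2 ^ 2 * n ^ (card V - 2)"
      unfolding card_graph_edge[OF assms(1) e] card_lessThan
      using assms(2) card_mono[of f "f \<inter> {..<n}"] card.infinite[of f]
      by (intro mult_right_mono power_mono) auto
    finally show "card ((\<lambda>\<phi>. (`) \<phi> ` E) ` ?\<Phi> e) \<le> 4 * n ^ (card V - 2)" by simp
  qed
  also have "\<dots> = card E * 4 * n ^ (card V - 2)" by simp
  finally show ?thesis .
qed

section \<open>Densities of subgraphs\<close>

lemma finite_densities:
  assumes "simple_graph V E"
  shows "finite {(real (card E') - 1) / (real (card V') - 2) | V' E'.
            is_subgraph V' E' V E \<and> card V' \<ge> 3}"
proof (rule finite_subset)
  show "finite ((\<lambda>(V', E'). (real (card E') - 1) / (real (card V') - 2)) ` (Pow V \<times> Pow E))"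
    using assms finite_graph_edges[OF assms] by (auto simp: simple_graph_def)
  show "{(real (card E') - 1) / (real (card V') - 2) | V' E'. is_subgraph V' E' V E \<and> card V' \<ge> 3}
      \<subseteq> (\<lambda>(V', E'). (real (card E') - 1) / (real (card V') - 2)) ` (Pow V \<times> Pow E)"
    unfolding is_subgraph_def by fast
qed

lemma max_density_ge:
  assumes "simple_graph V E" "is_subgraph V' E' V E" "card V' \<ge> 3"
  shows "(real (card E') - 1) / (real (card V') - 2) \<le> max_density V E"
  unfolding max_density_def using assms by (intro Max_ge finite_densities) auto

text \<open>An overlap of two copies will be given by its edge set \<open>J\<close> only. Its span
  turns it into a subgraph, to which the bound by \<open>max_density\<close> applies.\<close>

lemma is_subgraph_edge_span:
  assumes "simple_graph V E" "J \<subseteq> E"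
  shows "is_subgraph (\<Union>J) J V E"
proof -
  have "\<Union>J \<subseteq> V" using assms graph_edge_subset by blast
  moreover have "J \<subseteq> [\<Union>J]\<^bsup>2\<^esup>"
    using assms unfolding simple_graph_def nsets_def by blast
  ultimately show ?thesis
    using assms finite_subset[of "\<Union>J" V] by (simp add: is_subgraph_def simple_graph_def)
qed

text \<open>This covers the spans that \<open>max_density\<close> leaves out: two vertices have room
  for one edge only.\<close>

lemma card_le_1_of_edge_span:
  assumes "simple_graph V E" "J \<subseteq> E" "card (\<Union>J) \<le> 2"
  shows "card J \<le> 1"
proof -
  have s: "finite (\<Union>J)" "J \<subseteq> [\<Union>J]\<^bsup>2\<^esup>"
    using is_subgraph_edge_span[OF assms(1,2)] by (auto simp: is_subgraph_def simple_graph_def)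
  have "card J \<le> card ([\<Union>J]\<^bsup>2\<^esup>)" using s by (intro card_mono finite_imp_finite_nsets)
  also have "\<dots> = card (\<Union>J) choose 2" by simp
  also have "\<dots> \<le> 2 choose 2" using assms(3) by (rule binomial_right_mono)
  finally show ?thesis by simp
qed

text \<open>Two edges span three or four vertices, hence have density 1 or 1/2. The bound makes the
  exponent 1 / m positive and at most 2.\<close>

lemma max_density_ge_half:
  assumes "simple_graph V E" "card E \<ge> 2"
  shows "max_density V E \<ge> 1 / 2"
proof -
  obtain J where J: "J \<subseteq> E" "card J = 2" using assms(2) obtain_subset_with_card_n by metis
  have "card (\<Union>J) \<le> (\<Sum>e\<in>J. card e)" by (rule card_Union_le_sum_card)
  also have "\<dots> = (\<Sum>e\<in>J. 2)" using J card_graph_edge[OF assms(1)] by (intro sum.cong) auto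
  finally have "card (\<Union>J) \<le> 4" using J by simp
  moreover have ge: "card (\<Union>J) \<ge> 3"
    using card_le_1_of_edge_span[OF assms(1) J(1)] J(2) by force
  ultimately have "1 / 2 \<le> (real (card J) - 1) / (real (card (\<Union>J)) - 2)"
    using J by (auto simp: field_simps)
  also have "\<dots> \<le> max_density V E"
    by (intro max_density_ge assms is_subgraph_edge_span J ge)
  finally show ?thesis .
qed

text \<open>The maximum ranges over a nonempty set because the graph itself has at least three
  vertices. It is positive, which forces a maximizer to have at least two edges.\<close>

lemma max_density_attained:
  assumes "simple_graph V E" "card E \<ge> 2"
  obtains V' E' where "is_subgraph V' E' V E" "card V' \<ge> 3" "card E' \<ge> 2"
    "max_density V E = (real (card E') - 1) / (real (card V') - 2)"
proof -
  have "is_subgraph V E V E" using assms(1) by (simp add: is_subgraph_def)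
  moreover have "card V \<ge> 3"
  proof (rule ccontr)
    assume "\<not> card V \<ge> 3"
    moreover have "\<Union>E \<subseteq> V" using graph_edge_subset[OF assms(1)] by blast
    ultimately have "card (\<Union>E) \<le> 2"
      using assms(1) card_mono[of V "\<Union>E"] by (auto simp: simple_graph_def)
    then show False using card_le_1_of_edge_span[OF assms(1), of E] assms(2) by simp
  qed
  ultimately have ne: "{(real (card E') - 1) / (real (card V') - 2) | V' E'.
            is_subgraph V' E' V E \<and> card V' \<ge> 3} \<noteq> {}" by blast
  from Max_in[OF finite_densities[OF assms(1)] ne] obtain V' E' where
    *: "is_subgraph V' E' V E" "card V' \<ge> 3"
    "max_density V E = (real (card E') - 1) / (real (card V') - 2)"
    unfolding max_density_def[symmetric] by blast
  then have "(real (card E') - 1) / (real (card V') - 2) > 0"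
    using max_density_ge_half[OF assms] by simp
  then have "card E' \<ge> 2" using *(2) by (auto simp: zero_less_divide_iff)
  with * show ?thesis using that by blast
qed

subsection \<open>Breaker's strategy\<close>

lemma maker_edges_Nil [simp]: "maker_edges [] = {}"
  and maker_edges_snoc [simp]: "maker_edges (h @ [(e, S)]) = insert e (maker_edges h)"
  and breaker_edges_Nil [simp]: "breaker_edges [] = {}"
  and breaker_edges_snoc [simp]: "breaker_edges (h @ [(e, S)]) = breaker_edges h \<union> S"
  by (auto simp: maker_edges_def breaker_edges_def)

text \<open>For \<open>p\<close> between 0 and 1 this is the expected number of copies through
  \<open>f\<close>, avoiding \<open>B\<close>, that become complete when \<open>f\<close> and,
  independently with probability \<open>p\<close>, each further edge are added to
  \<open>M\<close>.\<close>

definition threat :: "real \<Rightarrow> nat set set set \<Rightarrow> nat set set \<Rightarrow> nat set set \<Rightarrow> nat set \<Rightarrow> real" where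
  "threat p F M B f = (\<Sum>C | C \<in> F \<and> f \<in> C \<and> C \<inter> B = {}. p ^ card (C - insert f M))"

text \<open>All threats are evaluated before the answer, so the edges of one answer do not influence
  each other. Claiming them can only lower the remaining threats.\<close>

definition threat_strategy :: "nat \<Rightarrow> real \<Rightarrow> nat set set set \<Rightarrow> strategy" where
  "threat_strategy n p F h e =
     {f \<in> free_edges n h - {e}. threat p F (insert e (maker_edges h)) (breaker_edges h) f \<ge> 1 / 2}"

lemma threat_antimono:
  assumes "finite F" "p \<ge> 0" "B \<subseteq> B'"
  shows "threat p F M B' f \<le> threat p F M B f"
  unfolding threat_def using assms by (intro sum_mono2) auto

text \<open>Only the copies through \<open>g\<close> change their weight. The extra sum is their
  whole new weight rather than the gain, which is precise enough.\<close>

lemma threat_insert_le: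
  assumes "finite F" "p \<ge> 0"
  shows "threat p F (insert g M) B f \<le> threat p F M B f +
    (\<Sum>C | C \<in> F \<and> g \<in> C \<and> f \<in> C \<and> C \<inter> B = {}. p ^ card (C - insert f (insert g M)))"
proof -
  have "threat p F (insert g M) B f =
      (\<Sum>C | C \<in> F \<and> f \<in> C \<and> C \<inter> B = {} \<and> g \<notin> C. p ^ card (C - insert f (insert g M))) +
      (\<Sum>C | C \<in> F \<and> g \<in> C \<and> f \<in> C \<and> C \<inter> B = {}. p ^ card (C - insert f (insert g M)))"
    unfolding threat_def using assms(1)
    by (subst sum.union_disjoint[symmetric]) (auto intro!: sum.cong)
  moreover have "(\<Sum>C | C \<in> F \<and> f \<in> C \<and> C \<inter> B = {} \<and> g \<notin> C. p ^ card (C - insert f (insert g M)))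
     = (\<Sum>C | C \<in> F \<and> f \<in> C \<and> C \<inter> B = {} \<and> g \<notin> C. p ^ card (C - insert f M))"
    by (intro sum.cong refl arg_cong[where f = "\<lambda>A. p ^ card A"]) auto
  moreover have "\<dots> \<le> threat p F M B f"
    unfolding threat_def using assms by (intro sum_mono2) auto
  ultimately show ?thesis by linarith
qed

text \<open>After interchanging the sums, a copy through \<open>g\<close> is counted for at most
  \<open>k\<close> edges \<open>f\<close>, each time with its weight in the threat of
  \<open>g\<close> divided by \<open>p\<close>.\<close>

lemma sum_threat_increase:
  assumes "finite F" "p > 0" and F: "\<And>C. C \<in> F \<Longrightarrow> finite C \<and> card C \<le> k"
    and "finite R" "R \<inter> insert g M = {}"
  shows "(\<Sum>f\<in>R. \<Sum>C | C \<in> F \<and> g \<in> C \<and> f \<in> C \<and> C \<inter> B = {}. p ^ card (C - insert f (insert g M)))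
     \<le> real k / p * threat p F M B g"
proof -
  let ?G = "{C \<in> F. g \<in> C \<and> C \<inter> B = {}}"
  have "(\<Sum>f\<in>R. \<Sum>C | C \<in> F \<and> g \<in> C \<and> f \<in> C \<and> C \<inter> B = {}. p ^ card (C - insert f (insert g M)))
     = (\<Sum>f\<in>R. \<Sum>C | C \<in> ?G \<and> f \<in> C. p ^ card (C - insert f (insert g M)))"
    by (intro sum.cong refl) auto
  also have "\<dots> = (\<Sum>C\<in>?G. \<Sum>f | f \<in> R \<and> f \<in> C. p ^ card (C - insert f (insert g M)))"
    using assms by (intro sum.swap_restrict) auto
  also have "\<dots> \<le> (\<Sum>C\<in>?G. real k / p * p ^ card (C - insert g M))"
  proof (rule sum_mono)
    fix C assume C: "C \<in> ?G"
    have "(\<Sum>f | f \<in> R \<and> f \<in> C. p ^ card (C - insert f (insert g M))) =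
        (\<Sum>f | f \<in> R \<and> f \<in> C. p ^ card (C - insert g M) / p)"
    proof (intro sum.cong refl)
      fix f assume "f \<in> {f \<in> R. f \<in> C}"
      \<comment> \<open>\<open>R\<close> avoids \<open>insert g M\<close>, so \<open>f\<close> is
        itself a missing edge, and leaving it out removes exactly one factor
        \<open>p\<close>.\<close>
      then have f: "f \<in> C - insert g M" using assms(5) by auto
      have "C - insert f (insert g M) = (C - insert g M) - {f}" by auto
      moreover have "card (C - insert g M) = Suc (card ((C - insert g M) - {f}))"
        using f C F by (intro card.remove) auto
      ultimately show "p ^ card (C - insert f (insert g M)) = p ^ card (C - insert g M) / p"
        using assms(2) by simp
    qed
    also have "\<dots> = real (card {f \<in> R. f \<in> C}) * (p ^ card (C - insert g M) / p)" by simp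
    also have "\<dots> \<le> real k * (p ^ card (C - insert g M) / p)"
    proof (intro mult_right_mono)
      have "card {f \<in> R. f \<in> C} \<le> card C" using C F by (intro card_mono) auto
      also have "\<dots> \<le> k" using C F by auto
      finally show "real (card {f \<in> R. f \<in> C}) \<le> real k" by simp
    qed (use assms(2) in simp)
    finally show "(\<Sum>f | f \<in> R \<and> f \<in> C. p ^ card (C - insert f (insert g M)))
        \<le> real k / p * p ^ card (C - insert g M)" by simp
  qed
  also have "\<dots> = real k / p * threat p F M B g"
    unfolding threat_def by (simp add: sum_distrib_left)
  finally show ?thesis .
qed

lemma threat_ge_1:
  assumes "finite F" "p \<ge> 0" "C \<in> F" "g \<in> C" "C \<inter> B = {}" "C \<subseteq> insert g M"
  shows "threat p F M B g \<ge> 1"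
proof -
  have "p ^ card (C - insert g M) \<le> threat p F M B g"
    unfolding threat_def using assms by (intro member_le_sum) auto
  moreover have "C - insert g M = {}" using assms by auto
  ultimately show ?thesis by simp
qed

text \<open>Breaker can pay a quarter for each of his edges f: since the threat of f starts below 1/4, the
  excess of f over 1/4 has dropped from at least 1/4 to nothing when f is claimed, and one edge of
  Maker, having threat less than 1/2 itself, raises the total excess by at most k / (2 p).\<close>

definition threat_invariant ::
    "nat \<Rightarrow> real \<Rightarrow> nat \<Rightarrow> nat set set set \<Rightarrow> nat set set \<Rightarrow> nat set set \<Rightarrow> bool" where
  "threat_invariant n p k F M B \<longleftrightarrow>
     M \<subseteq> K_edges n \<and> B \<subseteq> K_edges n \<and> M \<inter> B = {} \<and> (\<forall>C\<in>F. \<not> C \<subseteq> M) \<and>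
     (\<forall>f \<in> K_edges n - (M \<union> B). threat p F M B f < 1 / 2) \<and>
     (\<Sum>f \<in> K_edges n - (M \<union> B). max (threat p F M B f - 1 / 4) 0) + real (card B) / 4
       \<le> real (card M) * (real k / (2 * p))"

text \<open>Breaker's new edges are paid for by their own excess, and his claims only lower the
  other threats. The edge \<open>e\<close> of Maker raises the total excess by at most
  \<open>k / (2 * p)\<close>, which is the growth of the right-hand side.\<close>

lemma threat_invariant_round:
  assumes "finite F" "p > 0" and F: "\<And>C. C \<in> F \<Longrightarrow> finite C \<and> card C \<le> k"
    and inv: "threat_invariant n p k F M B"
    and e: "e \<in> K_edges n - (M \<union> B)"
    and S: "S = {f \<in> K_edges n - (M \<union> B) - {e}. threat p F (insert e M) B f \<ge> 1 / 2}"
  shows "threat_invariant n p k F (insert e M) (B \<union> S)"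
proof -
  let ?R = "K_edges n - (M \<union> B) - {e}"
  let ?x = "\<lambda>t::real. max (t - 1 / 4) 0"
  have sub: "M \<subseteq> K_edges n" "B \<subseteq> K_edges n" "M \<inter> B = {}"
    and nowin: "\<And>C. C \<in> F \<Longrightarrow> \<not> C \<subseteq> M"
    and small: "\<And>f. f \<in> K_edges n - (M \<union> B) \<Longrightarrow> threat p F M B f < 1 / 2"
    and pot: "(\<Sum>f \<in> K_edges n - (M \<union> B). ?x (threat p F M B f)) + real (card B) / 4
       \<le> real (card M) * (real k / (2 * p))"
    using inv unfolding threat_invariant_def by auto
  have fin: "finite M" "finite B" "finite S" "finite ?R"
    using sub S finite_subset[OF _ finite_K_edges] by auto
  have R': "K_edges n - (insert e M \<union> (B \<union> S)) = ?R - S" and SR: "S \<subseteq> ?R"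
    using S by auto
  have "(\<Sum>f \<in> ?R - S. ?x (threat p F (insert e M) (B \<union> S) f)) + real (card (B \<union> S)) / 4
      = (\<Sum>f \<in> ?R - S. ?x (threat p F (insert e M) (B \<union> S) f)) + (\<Sum>f\<in>S. 1 / 4) + real (card B) / 4"
    using fin SR by (subst card_Un_disjoint) auto
  \<comment> \<open>An edge of \<open>S\<close> has threat at least 1/2, hence excess at least 1/4,
    the price charged for it.\<close>
  also have "\<dots> \<le> (\<Sum>f \<in> ?R - S. ?x (threat p F (insert e M) B f)) +
      (\<Sum>f\<in>S. ?x (threat p F (insert e M) B f)) + real (card B) / 4"
  proof (intro add_mono sum_mono order.refl)
    fix f show "?x (threat p F (insert e M) (B \<union> S) f) \<le> ?x (threat p F (insert e M) B f)"
      using threat_antimono[OF assms(1), of p B "B \<union> S" "insert e M" f] assms(2) by auto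
  qed (auto simp: S)
  also have "\<dots> = (\<Sum>f\<in>?R. ?x (threat p F (insert e M) B f)) + real (card B) / 4"
    by (simp add: sum.subset_diff[OF SR fin(4), of "\<lambda>f. ?x (threat p F (insert e M) B f)"])
  also have "\<dots> \<le> (\<Sum>f\<in>?R. ?x (threat p F M B f) +
      (\<Sum>C | C \<in> F \<and> e \<in> C \<and> f \<in> C \<and> C \<inter> B = {}. p ^ card (C - insert f (insert e M))))
      + real (card B) / 4"
  proof (intro add_mono sum_mono order.refl)
    fix f
    have "0 \<le> (\<Sum>C | C \<in> F \<and> e \<in> C \<and> f \<in> C \<and> C \<inter> B = {}. p ^ card (C - insert f (insert e M)))"
      using assms(2) by (intro sum_nonneg) auto
    then show "?x (threat p F (insert e M) B f) \<le> ?x (threat p F M B f) +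
      (\<Sum>C | C \<in> F \<and> e \<in> C \<and> f \<in> C \<and> C \<inter> B = {}. p ^ card (C - insert f (insert e M)))"
      using threat_insert_le[OF assms(1), of p e M B f] assms(2) by auto
  qed
  also have "\<dots> \<le> (\<Sum>f\<in>?R. ?x (threat p F M B f)) + real k / p * threat p F M B e + real (card B) / 4"
    unfolding sum.distrib using assms fin(4)
    by (intro add_mono sum_threat_increase order.refl) auto
  \<comment> \<open>Before the round \<open>e\<close> was unclaimed, so the invariant bounds its
    threat by 1/2. Its nonnegative excess is put back into the sum.\<close>
  also have "\<dots> \<le> (\<Sum>f \<in> K_edges n - (M \<union> B). ?x (threat p F M B f)) + real k / p * (1 / 2) + real (card B) / 4"
    using small[OF e] assms(2) by (intro add_mono sum_mono2 mult_left_mono) auto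
  also have "\<dots> \<le> real (card M) * (real k / (2 * p)) + real k / p * (1 / 2)"
    using pot by simp
  also have "\<dots> = real (card (insert e M)) * (real k / (2 * p))"
    using e fin(1) by (simp add: algebra_simps add_divide_distrib)
  finally have pot': "(\<Sum>f \<in> ?R - S. ?x (threat p F (insert e M) (B \<union> S) f)) + real (card (B \<union> S)) / 4
    \<le> real (card (insert e M)) * (real k / (2 * p))" .
  have small': "threat p F (insert e M) (B \<union> S) f < 1 / 2" if "f \<in> ?R - S" for f
    using that S threat_antimono[OF assms(1), of p B "B \<union> S" "insert e M" f] assms(2) by auto
  \<comment> \<open>A copy completed by \<open>e\<close> would have given \<open>e\<close> a threat
    of at least 1 before the move.\<close>
  have nowin': "\<not> C \<subseteq> insert e M" if C: "C \<in> F" for C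
  proof
    assume sub': "C \<subseteq> insert e M"
    then have "e \<in> C" "C \<inter> B = {}" using nowin[OF C] e sub(3) by auto
    then have "threat p F M B e \<ge> 1" using assms(1,2) C sub' by (intro threat_ge_1) auto
    then show False using small[OF e] by simp
  qed
  show ?thesis
    unfolding threat_invariant_def R'
  proof (intro conjI ballI)
    show "insert e M \<subseteq> K_edges n" "B \<union> S \<subseteq> K_edges n" "insert e M \<inter> (B \<union> S) = {}"
      using sub e S by auto
  qed (use small' nowin' pot' in blast)+
qed

lemma threat_strategy_wins:
  assumes F: "\<And>C. C \<in> F \<Longrightarrow> C \<subseteq> K_edges n \<and> C \<noteq> {} \<and> card C \<le> k"
    and "p > 0"
    and init: "\<And>f. f \<in> K_edges n \<Longrightarrow> threat p F {} {} f \<le> 1 / 4"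
    and q: "2 * real k / p \<le> real q"
  shows "legal_strategy n q (threat_strategy n p F)"
    and "consistent_history n (threat_strategy n p F) h \<Longrightarrow> free_edges n h = {} \<Longrightarrow>
      C \<in> F \<Longrightarrow> C \<inter> breaker_edges h \<noteq> {}"
proof -
  let ?\<sigma> = "threat_strategy n p F"
  have finF: "finite F"
    using F by (intro finite_subset[of F "Pow (K_edges n)"]) auto
  have F': "finite C \<and> card C \<le> k" if "C \<in> F" for C
    using F[OF that] finite_subset[OF _ finite_K_edges] by auto
  have step: "threat_invariant n p k F (insert e (maker_edges h)) (breaker_edges h \<union> ?\<sigma> h e)"
    if "threat_invariant n p k F (maker_edges h) (breaker_edges h)" "e \<in> free_edges n h" for h e
    using that by (intro threat_invariant_round[OF finF assms(2) F'])
      (auto simp: free_edges_def threat_strategy_def)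
  have inv: "threat_invariant n p k F (maker_edges h) (breaker_edges h)"
    if "consistent_history n ?\<sigma> h" for h
    using that
  proof induction
    case start
    have "(\<Sum>f\<in>K_edges n. max (threat p F {} {} f - 1 / 4) 0) = 0"
      using init by (intro sum.neutral) (auto simp: max_def)
    moreover have "threat p F {} {} f < 1 / 2" if "f \<in> K_edges n" for f
      using init[OF that] by simp
    ultimately show ?case using F by (auto simp: threat_invariant_def)
  next
    case (round h e)
    then show ?case using step by simp
  qed
  show "legal_strategy n q ?\<sigma>"
    unfolding legal_strategy_def legal_answer_def
  proof (intro allI impI conjI, goal_cases)
    case (1 h e)
    show ?case by (auto simp: threat_strategy_def)
  next
    case (2 h e)
    let ?M = "insert e (maker_edges h)" and ?B = "breaker_edges h \<union> ?\<sigma> h e"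
    have "threat_invariant n p k F ?M ?B"
      using 2 inv step by blast
    then have "(\<Sum>f \<in> K_edges n - (?M \<union> ?B). max (threat p F ?M ?B f - 1 / 4) 0) + real (card ?B) / 4
       \<le> real (card ?M) * (real k / (2 * p))"
      unfolding threat_invariant_def by blast
    moreover have "(\<Sum>f \<in> K_edges n - (?M \<union> ?B). max (threat p F ?M ?B f - 1 / 4) 0) \<ge> 0"
      by (intro sum_nonneg) auto
    \<comment> \<open>Without the excess, \<open>4 * k / (2 * p) = 2 * k / p\<close> edges of
      Breaker remain per edge of Maker; this is where the condition on \<open>q\<close> comes
      from.\<close>
    ultimately have "real (card ?B) / 4 \<le> real (card ?M) * (real k / (2 * p))" by linarith
    then have "real (card ?B) \<le> real (card ?M) * (2 * real k / p)"
      using assms(2) by (simp add: field_simps)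
    also have "\<dots> \<le> real (card ?M) * real q" using q by (intro mult_left_mono) auto
    finally have "real (card ?B) \<le> real (q * card ?M)" by (simp add: mult.commute)
    then show ?case unfolding of_nat_le_iff by simp
  qed
  show "C \<inter> breaker_edges h \<noteq> {}"
    if "consistent_history n ?\<sigma> h" "free_edges n h = {}" "C \<in> F"
  proof -
    have "\<not> C \<subseteq> maker_edges h"
      using inv[OF that(1)] that(3) unfolding threat_invariant_def by blast
    moreover have "C \<subseteq> maker_edges h \<union> breaker_edges h"
      using that(2) F[OF that(3)] unfolding free_edges_def by blast
    ultimately show ?thesis by blast
  qed
qed

section \<open>Upper bound on the threshold bias\<close>

lemma threat_initial_le:
  assumes "simple_graph V E" "f \<in> K_edges n" "p \<ge> 0"
  shows "threat p (copies V E n) {} {} f \<le> 4 * real (card E) * real n ^ (card V - 2) * p ^ (card E - 1)"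
proof -
  have "threat p (copies V E n) {} {} f =
      (\<Sum>C | C \<in> copies V E n \<and> f \<in> C. p ^ (card E - 1))"
    unfolding threat_def
  proof (intro sum.cong refl)
    fix C assume C: "C \<in> {C \<in> copies V E n. f \<in> C}"
    then have "card (C - {f}) = card E - 1"
      using copy_edges(2)[OF assms(1), of C n] by auto
    then show "p ^ card (C - {f}) = p ^ (card E - 1)" by simp
  qed auto
  also have "\<dots> = real (card {C \<in> copies V E n. f \<in> C}) * p ^ (card E - 1)" by simp
  also have "\<dots> \<le> real (card E * 4 * n ^ (card V - 2)) * p ^ (card E - 1)"
  proof (intro mult_right_mono)
    have "card f = 2" using assms(2) by (auto simp: K_edges_def nsets_def)
    then show "real (card {C \<in> copies V E n. f \<in> C}) \<le> real (card E * 4 * n ^ (card V - 2))"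
      unfolding of_nat_le_iff by (rule card_copies_through_edge[OF assms(1)])
  qed (use assms(3) in simp)
  also have "\<dots> = 4 * real (card E) * real n ^ (card V - 2) * p ^ (card E - 1)" by simp
  finally show ?thesis .
qed

lemma breaker_wins_bound:
  assumes G: "simple_graph V E" and E: "card E \<ge> 2"
  obtains C where "C > 0"
    "\<And>n q. n > 0 \<Longrightarrow> real q \<ge> C * real n powr (1 / max_density V E) \<Longrightarrow>
       \<exists>\<sigma>. breaker_winning_strategy V E n q \<sigma>"
proof -
  obtain V' E' where H: "is_subgraph V' E' V E" "card V' \<ge> 3" "card E' \<ge> 2"
    "max_density V E = (real (card E') - 1) / (real (card V') - 2)"
    using max_density_attained[OF G E] .
  have G': "simple_graph V' E'" using H(1) by (simp add: is_subgraph_def)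
  let ?m = "max_density V E" and ?k = "card E'"
  \<comment> \<open>The initial threats will be at most \<open>4 * ?k * c ^ (?k - 1)\<close>. Since
    \<open>?k - 1 \<ge> 1\<close> and \<open>c \<le> 1\<close>, this choice brings them down to
    1/4.\<close>
  define c where "c = 1 / (16 * real ?k)"
  have c: "c > 0" "c \<le> 1" using H(3) by (auto simp: c_def field_simps)
  show ?thesis
  proof
    show "2 * real ?k / c > 0" using c H(3) by auto
    fix n q :: nat assume n: "n > 0" and q: "real q \<ge> 2 * real ?k / c * real n powr (1 / ?m)"
    define p where "p = c * real n powr (- (1 / ?m))"
    have p: "p > 0" using c n by (simp add: p_def)
    \<comment> \<open>Since \<open>1 / ?m\<close> equals \<open>(card V' - 2) / (?k - 1)\<close>,
      the powers of \<open>n\<close> in the initial threat cancel; this dictates the order of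
      \<open>p\<close>.\<close>
    have "real n ^ (card V' - 2) * (real n powr (- (1 / ?m))) ^ (?k - 1) =
        real n powr real (card V' - 2) * real n powr (- (1 / ?m) * real (?k - 1))"
      using n by (simp add: powr_realpow[symmetric] powr_powr)
    also have "\<dots> = real n powr (real (card V' - 2) - 1 / ?m * real (?k - 1))"
      by (simp flip: powr_add)
    also have "1 / ?m * real (?k - 1) = real (card V' - 2)"
      unfolding H(4) using H(2,3) by (simp add: of_nat_diff)
    finally have pw: "real n ^ (card V' - 2) * (real n powr (- (1 / ?m))) ^ (?k - 1) = 1"
      using n by simp
    let ?\<sigma> = "threat_strategy n p (copies V' E' n)"
    have init: "threat p (copies V' E' n) {} {} f \<le> 1 / 4" if f: "f \<in> K_edges n" for f
    proof -
      have "threat p (copies V' E' n) {} {} f \<le> 4 * real ?k * real n ^ (card V' - 2) * p ^ (?k - 1)"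
        using G' f p by (intro threat_initial_le) auto
      also have "\<dots> = 4 * real ?k * c ^ (?k - 1) *
          (real n ^ (card V' - 2) * (real n powr (- (1 / ?m))) ^ (?k - 1))"
        by (simp add: p_def power_mult_distrib)
      also have "\<dots> = 4 * real ?k * c ^ (?k - 1)" unfolding pw by simp
      also have "\<dots> \<le> 4 * real ?k * c ^ 1"
        using c H(3) by (intro mult_left_mono power_decreasing) auto
      also have "\<dots> = 1 / 4" using H(3) by (simp add: c_def)
      finally show ?thesis .
    qed
    have F: "C \<subseteq> K_edges n \<and> C \<noteq> {} \<and> card C \<le> ?k" if "C \<in> copies V' E' n" for C
      using copy_edges[OF G' that] H(3) by auto
    have "2 * real ?k / p = 2 * real ?k / c * real n powr (1 / ?m)"
      using n by (simp add: p_def powr_minus field_simps)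
    then have q': "2 * real ?k / p \<le> real q" using q by simp
    note wins = threat_strategy_wins[OF F p init q']
    have "breaker_winning_strategy V E n q ?\<sigma>"
      unfolding breaker_winning_strategy_def breaker_wins_play_def
    proof (intro conjI allI impI ballI wins(1))
      fix h C
      assume "consistent_history n ?\<sigma> h \<and> free_edges n h = {}" "C \<in> copies V E n"
      moreover obtain C' where "C' \<in> copies V' E' n" "C' \<subseteq> C"
        using copy_contains_subgraph_copy[OF H(1) G \<open>C \<in> copies V E n\<close>] .
      ultimately show "C \<inter> breaker_edges h \<noteq> {}"
        using wins(2)[of h C'] by blast
    qed
    then show "\<exists>\<sigma>. breaker_winning_strategy V E n q \<sigma>" by blast
  qed
qed

subsection \<open>Maker's random play\<close>

lemma consistent_history_legal:
  assumes "legal_strategy n q \<sigma>" "consistent_history n \<sigma> h"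
  shows "maker_edges h \<union> breaker_edges h \<subseteq> K_edges n" "maker_edges h \<inter> breaker_edges h = {}"
    "card (breaker_edges h) \<le> q * card (maker_edges h)"
proof -
  have "maker_edges h \<union> breaker_edges h \<subseteq> K_edges n \<and> maker_edges h \<inter> breaker_edges h = {} \<and>
    card (breaker_edges h) \<le> q * card (maker_edges h)"
    using assms(2)
  proof induction
    case (round h e)
    then have "legal_answer n q h e (\<sigma> h e)" using assms(1) by (auto simp: legal_strategy_def)
    with round show ?case by (auto simp: legal_answer_def free_edges_def)
  qed simp
  then show "maker_edges h \<union> breaker_edges h \<subseteq> K_edges n" "maker_edges h \<inter> breaker_edges h = {}"
    "card (breaker_edges h) \<le> q * card (maker_edges h)" by auto
qed

text \<open>The outcome is read off only when no edge is free. A partial play reaches such a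
  position by letting Maker claim arbitrary free edges, and she keeps what she has.\<close>

lemma consistent_history_completion:
  assumes "consistent_history n \<sigma> h"
  shows "\<exists>h'. consistent_history n \<sigma> h' \<and> free_edges n h' = {} \<and> maker_edges h \<subseteq> maker_edges h'"
  using assms
proof (induction "card (free_edges n h)" arbitrary: h rule: less_induct)
  case less
  show ?case
  proof (cases "free_edges n h = {}")
    case False
    then obtain e where e: "e \<in> free_edges n h" by auto
    let ?h = "h @ [(e, \<sigma> h e)]"
    have "free_edges n ?h \<subset> free_edges n h"
      using e by (auto simp: free_edges_def)
    then have "card (free_edges n ?h) < card (free_edges n h)"
      by (intro psubset_card_mono) (auto simp: free_edges_def)
    from less.hyps[OF this] consistent_history.round[OF less.prems e] show ?thesis
      by fastforce
  qed (use less.prems in blast)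
qed

text \<open>Maker tries to claim \<open>x i\<close> in attempt \<open>i\<close>. If the edge is
  taken, by either player, no round takes place, so attempts and rounds are numbered
  differently.\<close>

primrec run :: "nat \<Rightarrow> strategy \<Rightarrow> (nat \<Rightarrow> nat set) \<Rightarrow> nat \<Rightarrow> history" where
  "run n \<sigma> x 0 = []"
| "run n \<sigma> x (Suc i) =
     (let h = run n \<sigma> x i in if x i \<in> free_edges n h then h @ [(x i, \<sigma> h (x i))] else h)"

lemma consistent_run: "consistent_history n \<sigma> (run n \<sigma> x i)"
  by (induction i) (auto simp: Let_def intro: consistent_history.intros)

lemma run_cong: "(\<And>j. j < i \<Longrightarrow> x j = y j) \<Longrightarrow> run n \<sigma> x i = run n \<sigma> y i"
  by (induction i) (auto simp: Let_def)

lemma run_maker_mono: "i \<le> j \<Longrightarrow> maker_edges (run n \<sigma> x i) \<subseteq> maker_edges (run n \<sigma> x j)"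
  by (induction j rule: dec_induct) (auto simp: Let_def)

lemma card_maker_run: "card (maker_edges (run n \<sigma> x i)) \<le> i"
proof (induction i)
  case (Suc i)
  have "card (insert e (maker_edges (run n \<sigma> x i))) \<le> Suc i" for e
    using Suc card_insert_le_m1[of "Suc i" "maker_edges (run n \<sigma> x i)" e] by simp
  then show ?case using Suc by (auto simp: Let_def)
qed simp

lemma card_breaker_run:
  assumes "legal_strategy n q \<sigma>" "i \<le> L"
  shows "card (breaker_edges (run n \<sigma> x i)) \<le> q * L"
proof -
  have "card (breaker_edges (run n \<sigma> x i)) \<le> q * card (maker_edges (run n \<sigma> x i))"
    by (rule consistent_history_legal(3)[OF assms(1) consistent_run])
  also have "\<dots> \<le> q * L"
    using card_maker_run[of n \<sigma> x i] assms(2) by (intro mult_left_mono) auto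
  finally show ?thesis .
qed

text \<open>An attempt fails only if Breaker owns the edge: when Maker already has it, nothing is
  lost.\<close>

lemma run_claims:
  assumes "x i \<in> K_edges n" "x i \<notin> breaker_edges (run n \<sigma> x i)" "i < L"
  shows "x i \<in> maker_edges (run n \<sigma> x L)"
proof -
  have "x i \<in> maker_edges (run n \<sigma> x (Suc i))"
    using assms by (auto simp: Let_def free_edges_def)
  then show ?thesis using run_maker_mono[of "Suc i" L n \<sigma> x] assms(3) by auto
qed

text \<open>If no attempt in \<open>I\<close> failed, Maker would own all of \<open>C\<close> and
  keep it, untouched by Breaker, until the end of the game.\<close>

lemma winning_strategy_blocks:
  assumes "breaker_winning_strategy V E n q \<sigma>" "C \<in> copies V E n" "C \<subseteq> K_edges n"
    and "I \<subseteq> {..<L}" "C = x ` I"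
  shows "\<exists>i\<in>I. x i \<in> breaker_edges (run n \<sigma> x i)"
proof (rule ccontr)
  assume "\<not> ?thesis"
  then have "x i \<in> maker_edges (run n \<sigma> x L)" if "i \<in> I" for i
    using that assms(3-5) by (intro run_claims) auto
  then have sub: "C \<subseteq> maker_edges (run n \<sigma> x L)" using assms(5) by auto
  obtain h where h: "consistent_history n \<sigma> h" "free_edges n h = {}"
    "maker_edges (run n \<sigma> x L) \<subseteq> maker_edges h"
    using consistent_history_completion[OF consistent_run] by blast
  have legal: "legal_strategy n q \<sigma>" and "breaker_wins_play V E n h"
    using assms(1) h by (auto simp: breaker_winning_strategy_def)
  then have "C \<inter> breaker_edges h \<noteq> {}" using assms(2) by (auto simp: breaker_wins_play_def)
  then show False
    using sub h(3) consistent_history_legal(2)[OF legal h(1)] by blast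
qed

text \<open>The coordinates other than \<open>i\<close> determine \<open>B x\<close>, which leaves
  at most \<open>b\<close> values for \<open>x i\<close>. In probabilistic terms, an independent
  uniform entry lies in \<open>B x\<close> with probability at most
  \<open>b / card S\<close>.\<close>

lemma card_PiE_adaptive:
  assumes "finite I" "i \<in> I" "finite S" "\<And>x. finite (B x) \<and> card (B x) \<le> b"
    and cong: "\<And>x y. (\<And>j. j \<in> I - {i} \<Longrightarrow> x j = y j) \<Longrightarrow> B x = B y"
  shows "card {x \<in> I \<rightarrow>\<^sub>E S. x i \<in> B x} \<le> b * card S ^ (card I - 1)"
proof -
  let ?r = "\<lambda>x. (restrict x (I - {i}), x i)"
  let ?T = "SIGMA y:(I - {i} \<rightarrow>\<^sub>E S). B y"
  have fin: "finite (I - {i} \<rightarrow>\<^sub>E S)" using assms(1,3) by (intro finite_PiE) auto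
  have "card {x \<in> I \<rightarrow>\<^sub>E S. x i \<in> B x} \<le> card ?T"
  proof (rule card_inj_on_le[where f = ?r])
    show "inj_on ?r {x \<in> I \<rightarrow>\<^sub>E S. x i \<in> B x}"
    proof (rule inj_onI)
      fix x y assume x: "x \<in> {x \<in> I \<rightarrow>\<^sub>E S. x i \<in> B x}" and y: "y \<in> {x \<in> I \<rightarrow>\<^sub>E S. x i \<in> B x}"
        and eq: "?r x = ?r y"
      have "x j = y j" if "j \<in> I" for j
        using eq that by (cases "j = i") (auto dest!: fun_cong[of _ _ j])
      then show "x = y" using x y by (auto intro: PiE_ext)
    qed
    show "?r ` {x \<in> I \<rightarrow>\<^sub>E S. x i \<in> B x} \<subseteq> ?T"
    proof (intro image_subsetI SigmaI)
      fix x assume x: "x \<in> {x \<in> I \<rightarrow>\<^sub>E S. x i \<in> B x}"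
      then show "restrict x (I - {i}) \<in> I - {i} \<rightarrow>\<^sub>E S" by auto
      \<comment> \<open>Restricting replaces \<open>x i\<close> by a default value, which
        \<open>B\<close> does not see.\<close>
      have "B (restrict x (I - {i})) = B x" by (intro cong) auto
      then show "x i \<in> B (restrict x (I - {i}))" using x by simp
    qed
    show "finite ?T" using fin assms(4) by (intro finite_SigmaI) auto
  qed
  also have "card ?T = (\<Sum>y \<in> I - {i} \<rightarrow>\<^sub>E S. card (B y))"
    using fin assms(4) by (intro card_SigmaI) auto
  also have "\<dots> \<le> (\<Sum>y \<in> I - {i} \<rightarrow>\<^sub>E S. b)" using assms(4) by (intro sum_mono) auto
  also have "\<dots> = b * card S ^ (card I - 1)"
    using assms(1,2) by (simp add: card_PiE card_Diff_singleton)
  finally show ?thesis .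
qed

text \<open>In terms of expectations: each of the \<open>L\<close> attempts fails with probability
  at most \<open>q * L / card (K_edges n)\<close>, because Breaker never has more than
  \<open>q * L\<close> edges during the run.\<close>

lemma sum_card_failures:
  assumes "legal_strategy n q \<sigma>"
  shows "(\<Sum>x \<in> {..<L} \<rightarrow>\<^sub>E K_edges n. card {i \<in> {..<L}. x i \<in> breaker_edges (run n \<sigma> x i)})
    \<le> L * (q * L) * card (K_edges n) ^ (L - 1)"
proof -
  let ?\<Omega> = "{..<L} \<rightarrow>\<^sub>E K_edges n" and ?B = "\<lambda>i x. breaker_edges (run n \<sigma> x i)"
  have fin: "finite ?\<Omega>" by (intro finite_PiE) auto
  have "(\<Sum>x \<in> ?\<Omega>. card {i \<in> {..<L}. x i \<in> ?B i x}) = (\<Sum>i<L. card {x \<in> ?\<Omega>. x i \<in> ?B i x})"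
    using sum.swap_restrict[OF fin, of "{..<L}" "\<lambda>_ _. 1::nat" "\<lambda>x i. x i \<in> ?B i x"] by simp
  also have "\<dots> \<le> (\<Sum>i<L. q * L * card (K_edges n) ^ (card {..<L} - 1))"
  proof (intro sum_mono card_PiE_adaptive)
    fix i :: nat and x :: "nat \<Rightarrow> nat set" assume i: "i \<in> {..<L}"
    have "?B i x \<subseteq> K_edges n"
      using consistent_history_legal(1)[OF assms consistent_run] by blast
    then show "finite (?B i x) \<and> card (?B i x) \<le> q * L"
      using card_breaker_run[OF assms, of i L x] i finite_subset[OF _ finite_K_edges] by auto
  next
    fix i :: nat and x y :: "nat \<Rightarrow> nat set"
    assume "i \<in> {..<L}" "\<And>j. j \<in> {..<L} - {i} \<Longrightarrow> x j = y j"
    then have "run n \<sigma> x i = run n \<sigma> y i" by (intro run_cong) auto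
    then show "?B i x = ?B i y" by simp
  qed auto
  finally show ?thesis by simp
qed

section \<open>Counting maps, and the effect of the maximum density\<close>

lemma card_PiE_prescribed:
  assumes "finite I" "J \<subseteq> I" "\<And>i. i \<in> J \<Longrightarrow> y i \<in> S"
  shows "card {x \<in> I \<rightarrow>\<^sub>E S. \<forall>i\<in>J. x i = y i} = card S ^ (card I - card J)"
proof -
  have "{x \<in> I \<rightarrow>\<^sub>E S. \<forall>i\<in>J. x i = y i} = (\<Pi>\<^sub>E i\<in>I. if i \<in> J then {y i} else S)"
  proof (intro equalityI subsetI)
    fix x assume x: "x \<in> (\<Pi>\<^sub>E i\<in>I. if i \<in> J then {y i} else S)"
    then have *: "x i \<in> (if i \<in> J then {y i} else S)" if "i \<in> I" for i
      using that by (auto simp: PiE_iff)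
    have "x i = y i" if "i \<in> J" for i using *[of i] that assms(2) by auto
    moreover have "x i \<in> S" if "i \<in> I" for i
      using *[OF that] assms(3) by (cases "i \<in> J") auto
    ultimately show "x \<in> {x \<in> I \<rightarrow>\<^sub>E S. \<forall>i\<in>J. x i = y i}"
      using x by (auto simp: PiE_iff)
  qed (auto simp: PiE_iff)
  also have "card \<dots> = (\<Prod>i\<in>I. if i \<in> J then 1 else card S)"
    using assms(1) by (simp add: card_PiE if_distrib cong: if_cong)
  also have "\<dots> = card S ^ (card I - card J)"
    using assms by (simp add: prod.If_cases Int_absorb1 card_Diff_subset finite_subset flip: Diff_eq)
  finally show ?thesis .
qed

text \<open>Every factor \<open>n - i\<close> of the falling factorial is at least
  \<open>n / 2\<close>.\<close>

lemma card_embeddings_ge: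
  assumes "finite V" "n \<ge> 2 * card V"
  shows "real n ^ card V \<le> 2 ^ card V * real (card {\<phi> \<in> V \<rightarrow>\<^sub>E {..<n}. inj_on \<phi> V})"
proof -
  have "real n ^ card V = (\<Prod>i<card V. real n)" by simp
  also have "\<dots> \<le> (\<Prod>i<card V. 2 * real (n - i))"
    using assms(2) by (intro prod_mono) auto
  also have "\<dots> = 2 ^ card V * real (\<Prod>i<card V. n - i)"
    by (simp add: prod.distrib)
  also have "(\<Prod>i<card V. n - i) = card {\<phi> \<in> V \<rightarrow>\<^sub>E {..<n}. inj_on \<phi> V}"
    using card_inj_on_subset_funcset[of V "{..<n}" V] assms(1) by (simp add: atLeast0LessThan)
  finally show ?thesis .
qed

text \<open>Up to constants, the right-hand side is the expected number of copies of the graph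
  spanned by \<open>J\<close> in a random graph of density \<open>p\<close>. The maximum density
  keeps it from dropping below the order of the number of edges. After division the claim is that
  \<open>n ^ (card (\<Union>J) - 2) * p ^ (card J - 1)\<close> is at least 1.\<close>

lemma density_power_ge:
  assumes G: "simple_graph V E" and "card E \<ge> 2" and J: "J \<subseteq> E" "J \<noteq> {}" and "n > 0"
    and p: "p \<ge> real n powr (- (1 / max_density V E))"
  shows "real n ^ 2 * p \<le> real n ^ card (\<Union>J) * p ^ card J"
proof -
  let ?m = "max_density V E" and ?w = "card (\<Union>J)" and ?j = "card J"
  have m: "?m > 0" using max_density_ge_half[OF assms(1,2)] by simp
  have p0: "p > 0" using p assms(5) by (metis powr_gt_zero of_nat_0_less_iff order_less_le_trans less_numeral_extra(3))
  have finJ: "finite J" using J(1) finite_graph_edges[OF G] finite_subset by blast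
  then have j: "?j \<ge> 1" using J(2) by (simp add: Suc_le_eq card_gt_0_iff)
  obtain e where e: "e \<in> J" using J(2) by blast
  have "finite (\<Union>J)"
    using is_subgraph_edge_span[OF G J(1)] by (simp add: is_subgraph_def simple_graph_def)
  then have w2: "?w \<ge> 2" using card_mono[of "\<Union>J" e] e J(1) card_graph_edge[OF G, of e] by (auto simp: Union_upper)
  have "1 \<le> real n ^ (?w - 2) * p ^ (?j - 1)"
  proof (cases "?w = 2")
    case True
    then have "?j = 1" using card_le_1_of_edge_span[OF G J(1)] j by simp
    then show ?thesis using True by simp
  next
    case False
    then have w: "?w \<ge> 3" using w2 by simp
    have "(real ?j - 1) / (real ?w - 2) \<le> ?m"
      by (intro max_density_ge G is_subgraph_edge_span J w)
    then have "real ?j - 1 \<le> ?m * (real ?w - 2)" using w by (simp add: pos_divide_le_eq)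
    then have "(real ?j - 1) / ?m \<le> real ?w - 2" using m by (simp add: pos_divide_le_eq mult.commute)
    then have "1 \<le> real n powr (real (?w - 2) + - (1 / ?m) * real (?j - 1))"
      using w j assms(5) by (intro ge_one_powr_ge_zero) (auto simp: of_nat_diff)
    also have "\<dots> = real n ^ (?w - 2) * (real n powr (- (1 / ?m))) ^ (?j - 1)"
      using assms(5) by (simp add: powr_realpow[symmetric] powr_powr flip: powr_add)
    also have "\<dots> \<le> real n ^ (?w - 2) * p ^ (?j - 1)"
      using p by (intro mult_left_mono power_mono) auto
    finally show ?thesis .
  qed
  then have "real n ^ 2 * p * 1 \<le> real n ^ 2 * p * (real n ^ (?w - 2) * p ^ (?j - 1))"
    using p0 by (intro mult_left_mono) auto
  also have "\<dots> = real n ^ (2 + (?w - 2)) * p ^ (1 + (?j - 1))"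
    by (simp only: power_add power_one_right ac_simps)
  also have "2 + (?w - 2) = ?w" using w2 by simp
  also have "1 + (?j - 1) = ?j" using j by simp
  finally show ?thesis by simp
qed

subsection \<open>The second moment\<close>

lemma sum_of_bool_pairs:
  assumes "finite A"
  shows "(\<Sum>x\<in>A. \<Sum>y\<in>A. of_bool (R x y)) = card {(x, y) \<in> A \<times> A. R x y}"
proof -
  have "{(x, y) \<in> A \<times> A. R x y} = (SIGMA x:A. {y \<in> A. R x y})" by auto
  then show ?thesis using assms by (simp add: Int_def)
qed

definition embeddings :: "'a set \<Rightarrow> nat \<Rightarrow> ('a \<Rightarrow> nat) set" where
  "embeddings V n = {\<phi> \<in> V \<rightarrow>\<^sub>E {..<n}. inj_on \<phi> V}"

definition agreement :: "'b set \<Rightarrow> ('b \<Rightarrow> 'c) \<Rightarrow> ('b \<Rightarrow> 'c) \<Rightarrow> 'b set" where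
  "agreement E \<tau> \<tau>' = {e \<in> E. \<tau> e = \<tau>' e}"

text \<open>A witness w pairs an embedding of V with the positions in x of the images of the edges.\<close>

definition shows_copy ::
    "'a set set \<Rightarrow> ('a \<Rightarrow> nat) \<times> ('a set \<Rightarrow> nat) \<Rightarrow> (nat \<Rightarrow> nat set) \<Rightarrow> bool" where
  "shows_copy E w x \<longleftrightarrow> (\<forall>e\<in>E. x (snd w e) = fst w ` e)"

text \<open>One block of \<open>s\<close> positions is reserved for each edge of the graph.
  Disjointness of the blocks makes placements injective and lets two placements share a position
  only at an edge where they agree.\<close>

locale position_blocks =
  fixes V :: "'a set" and E :: "'a set set" and n s L :: nat and P :: "'a set \<Rightarrow> nat set"
  assumes graph: "simple_graph V E"
    and n2: "n \<ge> 2"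
    and P_sub: "\<And>e. e \<in> E \<Longrightarrow> P e \<subseteq> {..<L}"
    and P_card: "\<And>e. e \<in> E \<Longrightarrow> card (P e) = s"
    and P_disj: "disjoint_family_on P E"
begin

abbreviation "K \<equiv> K_edges n"
abbreviation "seqs \<equiv> {..<L} \<rightarrow>\<^sub>E K"
abbreviation "placements \<equiv> PiE E P"
abbreviation "witnesses \<equiv> embeddings V n \<times> placements"

lemma finE: "finite E" and finV: "finite V"
  using graph finite_graph_edges by (auto simp: simple_graph_def)

lemma finP: "e \<in> E \<Longrightarrow> finite (P e)"
  using P_sub finite_subset by blast

lemma finite_seqs: "finite seqs" by (intro finite_PiE) auto

lemma finite_embeddings: "finite (embeddings V n)"
  unfolding embeddings_def using finV by (simp add: finite_PiE)

lemma finite_placements: "finite placements" using finE finP by (intro finite_PiE) auto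

lemma card_placements: "card placements = s ^ card E"
  using finE P_card by (simp add: card_PiE)

lemma placement_less: "\<tau> \<in> placements \<Longrightarrow> e \<in> E \<Longrightarrow> \<tau> e < L"
  using P_sub by fastforce

lemma placement_eqD:
  assumes "\<tau> \<in> placements" "\<tau>' \<in> placements" "e \<in> E" "e' \<in> E" "\<tau> e = \<tau>' e'"
  shows "e = e'"
proof (rule ccontr)
  assume "e \<noteq> e'"
  then have "P e \<inter> P e' = {}" using P_disj assms(3,4) by (auto simp: disjoint_family_on_def)
  moreover have "\<tau> e \<in> P e" "\<tau>' e' \<in> P e'"
    using PiE_mem[OF assms(1,3)] PiE_mem[OF assms(2,4)] by auto
  ultimately show False using assms(5) by auto
qed

lemma inj_placement: "\<tau> \<in> placements \<Longrightarrow> inj_on \<tau> E"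
  by (meson inj_onI placement_eqD)

lemma placement_Int:
  assumes "\<tau> \<in> placements" "\<tau>' \<in> placements"
  shows "\<tau> ` E \<inter> \<tau>' ` E = \<tau> ` agreement E \<tau> \<tau>'"
proof (intro equalityI subsetI)
  fix i assume "i \<in> \<tau> ` E \<inter> \<tau>' ` E"
  then obtain e e' where "e \<in> E" "e' \<in> E" "i = \<tau> e" "\<tau> e = \<tau>' e'" by auto
  moreover from this have "e = e'" using assms placement_eqD by blast
  ultimately show "i \<in> \<tau> ` agreement E \<tau> \<tau>'" by (auto simp: agreement_def)
qed (force simp: agreement_def image_iff)

lemma card_placement_Int:
  assumes "\<tau> \<in> placements" "\<tau>' \<in> placements"
  shows "card (\<tau> ` E \<inter> \<tau>' ` E) = card (agreement E \<tau> \<tau>')"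
  unfolding placement_Int[OF assms]
  by (intro card_image inj_on_subset[OF inj_placement[OF assms(1)]]) (auto simp: agreement_def)

lemma card_placement_Un:
  assumes "\<tau> \<in> placements" "\<tau>' \<in> placements"
  shows "card (\<tau> ` E \<union> \<tau>' ` E) = 2 * card E - card (agreement E \<tau> \<tau>')"
  using card_Un_Int[of "\<tau> ` E" "\<tau>' ` E"] finE card_placement_Int[OF assms]
  by (simp add: card_image inj_placement assms)

lemma card_seqs_showing_copy:
  assumes w: "w \<in> witnesses"
  shows "card {x \<in> seqs. shows_copy E w x} = card K ^ (L - card E)"
proof -
  obtain \<phi> \<tau> where w': "w = (\<phi>, \<tau>)" "\<phi> \<in> V \<rightarrow>\<^sub>E {..<n}" "inj_on \<phi> V" "\<tau> \<in> placements"
    using w by (auto simp: embeddings_def)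
  let ?y = "\<lambda>i. \<phi> ` (inv_into E \<tau> i)"
  have y: "?y (\<tau> e) = \<phi> ` e" if "e \<in> E" for e
    using that inj_placement[OF w'(4)] by simp
  have "{x \<in> seqs. shows_copy E w x} = {x \<in> seqs. \<forall>i \<in> \<tau> ` E. x i = ?y i}"
    using y by (auto simp: shows_copy_def w'(1))
  also have "card \<dots> = card K ^ (card {..<L} - card (\<tau> ` E))"
  proof (rule card_PiE_prescribed)
    show "\<tau> ` E \<subseteq> {..<L}" using w'(4) placement_less by blast
    show "?y i \<in> K" if i: "i \<in> \<tau> ` E" for i
    proof -
      have "(`) \<phi> ` E \<subseteq> K"
        using image_graph_subset_K_edges[OF graph w'(3)] w'(2) by (simp add: PiE_iff image_subset_iff)
      moreover obtain e where "e \<in> E" "i = \<tau> e" using i by blast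
      ultimately show ?thesis using y[of e] by auto
    qed
  qed auto
  finally show ?thesis by (simp add: card_image inj_placement[OF w'(4)])
qed

text \<open>Together the witnesses prescribe \<open>2 * card E - card J\<close> positions. A
  sequence showing both forces the embeddings to map each edge of \<open>J\<close> to the same edge;
  only the resulting inclusion of vertex images is kept, which suffices to limit the pairs of
  embeddings.\<close>

lemma card_seqs_showing_two_copies:
  assumes "w \<in> witnesses" "w' \<in> witnesses"
  defines "J \<equiv> agreement E (snd w) (snd w')"
  shows "card {x \<in> seqs. shows_copy E w x \<and> shows_copy E w' x}
    \<le> (if fst w' ` \<Union>J \<subseteq> fst w ` \<Union>J then card K ^ (L - (2 * card E - card J)) else 0)"
proof (cases "\<exists>y \<in> seqs. shows_copy E w y \<and> shows_copy E w' y")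
  case True
  then obtain y where y: "y \<in> seqs" "shows_copy E w y" "shows_copy E w' y" by blast
  let ?I = "snd w ` E \<union> snd w' ` E"
  have \<tau>: "snd w \<in> placements" "snd w' \<in> placements" using assms by auto
  have I: "?I \<subseteq> {..<L}" using \<tau> placement_less by blast
  have "fst w' ` e = fst w ` e" if "e \<in> J" for e
  proof -
    have "e \<in> E" "snd w e = snd w' e" using that by (auto simp: J_def agreement_def)
    then show ?thesis using y(2,3) unfolding shows_copy_def by metis
  qed
  then have "fst w' ` \<Union>J \<subseteq> fst w ` \<Union>J" by blast
  moreover have "card {x \<in> seqs. shows_copy E w x \<and> shows_copy E w' x}
      \<le> card {x \<in> seqs. \<forall>i\<in>?I. x i = y i}"
    using y(2,3) finite_seqs by (intro card_mono) (auto simp: shows_copy_def)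
  moreover have "card {x \<in> seqs. \<forall>i\<in>?I. x i = y i} = card K ^ (card {..<L} - card ?I)"
    using I y(1) by (intro card_PiE_prescribed) (auto simp: PiE_iff)
  ultimately show ?thesis by (simp add: card_placement_Un[OF \<tau>] J_def)
next
  case False
  then have "{x \<in> seqs. shows_copy E w x \<and> shows_copy E w' x} = {}" by blast
  then show ?thesis by (metis card.empty le0)
qed

text \<open>The first moment: every witness is shown by the same number of sequences.\<close>

lemma sum_card_copies:
  "(\<Sum>x\<in>seqs. card {w \<in> witnesses. shows_copy E w x})
     = card (embeddings V n) * s ^ card E * card K ^ (L - card E)"
proof -
  have fin: "finite witnesses" using finite_embeddings finite_placements by simp
  have "(\<Sum>x\<in>seqs. card {w \<in> witnesses. shows_copy E w x})
      = (\<Sum>w\<in>witnesses. card {x \<in> seqs. shows_copy E w x})"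
    using sum.swap_restrict[OF finite_seqs fin, of "\<lambda>_ _. 1::nat" "\<lambda>x w. shows_copy E w x"] by simp
  also have "\<dots> = (\<Sum>w\<in>witnesses. card K ^ (L - card E))"
    by (intro sum.cong refl card_seqs_showing_copy)
  finally show ?thesis by (simp add: card_cartesian_product card_placements)
qed

text \<open>Given \<open>\<tau>\<close>, the second placement is determined on \<open>J\<close> and
  has \<open>s\<close> choices at each remaining edge.\<close>

lemma card_placement_pairs:
  assumes "J \<subseteq> E"
  shows "card {(\<tau>, \<tau>') \<in> placements \<times> placements. agreement E \<tau> \<tau>' = J}
    \<le> s ^ card E * s ^ (card E - card J)"
proof -
  have "{(\<tau>, \<tau>') \<in> placements \<times> placements. agreement E \<tau> \<tau>' = J}
      \<subseteq> (SIGMA \<tau>:placements. \<Pi>\<^sub>E e\<in>E. if e \<in> J then {\<tau> e} else P e)"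
    by (auto simp: PiE_iff agreement_def extensional_def)
  moreover have fin: "finite (\<Pi>\<^sub>E e\<in>E. if e \<in> J then {\<tau> e} else P e)" for \<tau> :: "'a set \<Rightarrow> nat"
    using finE finP by (intro finite_PiE) auto
  ultimately have "card {(\<tau>, \<tau>') \<in> placements \<times> placements. agreement E \<tau> \<tau>' = J}
      \<le> card (SIGMA \<tau>:placements. \<Pi>\<^sub>E e\<in>E. if e \<in> J then {\<tau> e} else P e)"
    using finite_placements by (intro card_mono finite_SigmaI)
  also have "\<dots> = (\<Sum>\<tau>\<in>placements. card (\<Pi>\<^sub>E e\<in>E. if e \<in> J then {\<tau> e} else P e))"
    using finite_placements fin by (intro card_SigmaI) auto
  also have "\<dots> = (\<Sum>\<tau>\<in>placements. s ^ (card E - card J))"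
  proof (intro sum.cong refl)
    fix \<tau> assume "\<tau> \<in> placements"
    have "card (\<Pi>\<^sub>E e\<in>E. if e \<in> J then {\<tau> e} else P e) = (\<Prod>e\<in>E. if e \<in> J then 1 else s)"
      unfolding card_PiE[OF finE] by (intro prod.cong) (auto simp: P_card)
    also have "\<dots> = s ^ (card E - card J)"
      using finE assms
      by (simp add: prod.If_cases Int_absorb1 card_Diff_subset finite_subset flip: Diff_eq)
    finally show "card (\<Pi>\<^sub>E e\<in>E. if e \<in> J then {\<tau> e} else P e) = s ^ (card E - card J)" .
  qed
  finally show ?thesis by (simp add: card_placements)
qed

text \<open>Given the first embedding, the second has at most \<open>card V\<close> choices at a
  vertex of \<open>W\<close> and at most \<open>n\<close> elsewhere. The constant
  \<open>card V ^ card V\<close> does not depend on \<open>W\<close>.\<close>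

lemma card_embedding_pairs:
  assumes "W \<subseteq> V"
  shows "card {(\<phi>, \<phi>') \<in> embeddings V n \<times> embeddings V n. \<phi>' ` W \<subseteq> \<phi> ` W}
    \<le> card (embeddings V n) * (card V ^ card V * n ^ (card V - card W))"
proof -
  let ?S = "\<lambda>\<phi>. {\<phi>' \<in> V \<rightarrow>\<^sub>E {..<n}. \<phi>' ` W \<subseteq> \<phi> ` W}"
  have fin: "finite (?S \<phi>)" for \<phi> :: "'a \<Rightarrow> nat" using finV by (simp add: finite_PiE)
  have "card {(\<phi>, \<phi>') \<in> embeddings V n \<times> embeddings V n. \<phi>' ` W \<subseteq> \<phi> ` W}
      \<le> card (SIGMA \<phi>:embeddings V n. ?S \<phi>)"
    using fin finite_embeddings by (intro card_mono finite_SigmaI) (auto simp: embeddings_def)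
  also have "\<dots> = (\<Sum>\<phi>\<in>embeddings V n. card (?S \<phi>))"
    using fin finite_embeddings by (intro card_SigmaI) auto
  also have "\<dots> \<le> (\<Sum>\<phi>\<in>embeddings V n. card V ^ card V * n ^ (card V - card W))"
  proof (rule sum_mono)
    fix \<phi>
    have finW: "finite W" using assms finV finite_subset by blast
    have "card (?S \<phi>) \<le> card (\<phi> ` W \<inter> {..<n}) ^ card W * card {..<n} ^ (card V - card W)"
      by (rule card_PiE_confined[OF finV assms])
    also have "\<dots> \<le> card V ^ card W * n ^ (card V - card W)"
    proof (intro mult_mono power_mono)
      have "card (\<phi> ` W \<inter> {..<n}) \<le> card (\<phi> ` W)" using finW by (intro card_mono) auto
      also have "\<dots> \<le> card W" by (rule card_image_le[OF finW])
      also have "\<dots> \<le> card V" by (rule card_mono[OF finV assms])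
      finally show "card (\<phi> ` W \<inter> {..<n}) \<le> card V" .
    qed auto
    also have "\<dots> \<le> card V ^ card V * n ^ (card V - card W)"
    \<comment> \<open>Monotonicity in the exponent needs a base of at least 1; for empty
      \<open>V\<close> both powers are \<open>0 ^ 0 = 1\<close>.\<close>
    proof (cases "card V = 0")
      case True
      then show ?thesis using assms finV by simp
    next
      case False
      then show ?thesis using card_mono[OF finV assms]
        by (intro mult_right_mono power_increasing) auto
    qed
    finally show "card (?S \<phi>) \<le> card V ^ card V * n ^ (card V - card W)" .
  qed
  finally show ?thesis by simp
qed

text \<open>A square counts pairs of witnesses, and summing over \<open>i\<close> counts their
  common positions. The pairs are sorted by the set \<open>J\<close> of edges placed alike; for
  empty \<open>J\<close> there is no common position and thus no contribution.\<close>

lemma sum_square_copies_at: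
  "(\<Sum>x\<in>seqs. \<Sum>i<L. (card {w \<in> witnesses. shows_copy E w x \<and> i \<in> snd w ` E})\<^sup>2)
    \<le> (\<Sum>J | J \<subseteq> E \<and> J \<noteq> {}. card E * card K ^ (L - (2 * card E - card J)) *
         (s ^ card E * s ^ (card E - card J)) *
         (card (embeddings V n) * (card V ^ card V * n ^ (card V - card (\<Union>J)))))"
proof -
  define A where "A = (\<lambda>x i. {w \<in> witnesses. shows_copy E w x \<and> i \<in> snd w ` E})"
  define Q where "Q = (\<lambda>x w w'. shows_copy E w x \<and> shows_copy E w' x)"
  define N where "N = (\<lambda>J::'a set set. card E * card K ^ (L - (2 * card E - card J)))"
  define a where "a = (\<lambda>(\<tau>::'a set \<Rightarrow> nat) \<tau>' (J::'a set set). agreement E \<tau> \<tau>' = J)"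
  define b where "b = (\<lambda>(\<phi>::'a \<Rightarrow> nat) \<phi>' J. \<phi>' ` \<Union>J \<subseteq> \<phi> ` \<Union>J)"
  let ?W2 = "witnesses \<times> witnesses"
  have fin: "finite witnesses" using finite_embeddings finite_placements by simp
  have finJ: "finite {J. J \<subseteq> E \<and> J \<noteq> {}}" using finE by simp
  have sq: "(card (A x i))\<^sup>2 = (\<Sum>(w, w')\<in>?W2. of_bool (Q x w w') * of_bool (i \<in> snd w ` E \<inter> snd w' ` E))"
    for x i
  proof -
    have "card (A x i) = (\<Sum>w\<in>witnesses. of_bool (shows_copy E w x \<and> i \<in> snd w ` E))"
      using fin by (simp add: A_def Int_def)
    then show ?thesis
      by (auto simp: power2_eq_square sum_product sum.cartesian_product Q_def intro!: sum.cong)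
  qed
  \<comment> \<open>Only the agreement set of the two placements gives a nonzero term on the right.
    Its size, at most \<open>card E\<close>, is the number of common positions.\<close>
  have pair: "card {x \<in> seqs. Q x w w'} * card (snd w ` E \<inter> snd w' ` E)
     \<le> (\<Sum>J | J \<subseteq> E \<and> J \<noteq> {}. N J * (of_bool (a (snd w) (snd w') J) * of_bool (b (fst w) (fst w') J)))"
    if w: "w \<in> witnesses" "w' \<in> witnesses" for w w'
  proof -
    let ?J = "agreement E (snd w) (snd w')"
    have \<tau>: "snd w \<in> placements" "snd w' \<in> placements" using w by auto
    have J: "?J \<subseteq> E" "card ?J \<le> card E"
      using finE by (auto simp: agreement_def intro: card_mono)
    show ?thesis
    proof (cases "?J = {}")
      case True
      then show ?thesis unfolding card_placement_Int[OF \<tau>] by simp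
    next
      case False
      have "card {x \<in> seqs. Q x w w'} * card ?J
          \<le> (card K ^ (L - (2 * card E - card ?J)) * of_bool (b (fst w) (fst w') ?J)) * card E"
        using card_seqs_showing_two_copies[OF w] J(2)
        by (intro mult_mono) (auto simp: Q_def b_def split: if_splits)
      also have "\<dots> = N ?J * (of_bool (a (snd w) (snd w') ?J) * of_bool (b (fst w) (fst w') ?J))"
        by (simp add: N_def a_def)
      also have "\<dots> \<le> (\<Sum>J | J \<subseteq> E \<and> J \<noteq> {}. N J * (of_bool (a (snd w) (snd w') J) * of_bool (b (fst w) (fst w') J)))"
        using J(1) False finJ by (intro member_le_sum) auto
      finally show ?thesis unfolding card_placement_Int[OF \<tau>] .
    qed
  qed
  \<comment> \<open>One condition concerns only the placements and the other only the embeddings, so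
    the count of pairs factors.\<close>
  have split: "(\<Sum>(w, w')\<in>?W2. of_bool (a (snd w) (snd w') J) * of_bool (b (fst w) (fst w') J))
     \<le> (s ^ card E * s ^ (card E - card J)) *
       (card (embeddings V n) * (card V ^ card V * n ^ (card V - card (\<Union>J))))"
    if J: "J \<subseteq> E" for J
  proof -
    have inner: "(\<Sum>\<phi>'\<in>embeddings V n. \<Sum>\<tau>'\<in>placements. of_bool (a \<tau> \<tau>' J) * of_bool (b \<phi> \<phi>' J)) =
        (\<Sum>\<tau>'\<in>placements. of_bool (a \<tau> \<tau>' J)) * (\<Sum>\<phi>'\<in>embeddings V n. of_bool (b \<phi> \<phi>' J) :: nat)"
      for \<tau> \<phi>
      unfolding sum_product by (rule sum.swap)
    have "(\<Sum>(w, w')\<in>?W2. of_bool (a (snd w) (snd w') J) * of_bool (b (fst w) (fst w') J))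
       = (\<Sum>\<phi>\<in>embeddings V n. \<Sum>\<tau>\<in>placements. \<Sum>\<phi>'\<in>embeddings V n. \<Sum>\<tau>'\<in>placements.
         of_bool (a \<tau> \<tau>' J) * of_bool (b \<phi> \<phi>' J) :: nat)"
      unfolding split_beta sum.cartesian_product' by simp
    also have "\<dots> = (\<Sum>\<tau>\<in>placements. \<Sum>\<tau>'\<in>placements. of_bool (a \<tau> \<tau>' J)) *
        (\<Sum>\<phi>\<in>embeddings V n. \<Sum>\<phi>'\<in>embeddings V n. of_bool (b \<phi> \<phi>' J))"
      unfolding inner sum_product[of _ placements _ "embeddings V n"] by (rule sum.swap)
    also have "(\<Sum>\<tau>\<in>placements. \<Sum>\<tau>'\<in>placements. of_bool (a \<tau> \<tau>' J))
        = card {(\<tau>, \<tau>') \<in> placements \<times> placements. a \<tau> \<tau>' J}"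
      by (rule sum_of_bool_pairs[OF finite_placements])
    also have "(\<Sum>\<phi>\<in>embeddings V n. \<Sum>\<phi>'\<in>embeddings V n. of_bool (b \<phi> \<phi>' J))
        = card {(\<phi>, \<phi>') \<in> embeddings V n \<times> embeddings V n. b \<phi> \<phi>' J}"
      by (rule sum_of_bool_pairs[OF finite_embeddings])
    also have "card {(\<tau>, \<tau>') \<in> placements \<times> placements. a \<tau> \<tau>' J} *
        card {(\<phi>, \<phi>') \<in> embeddings V n \<times> embeddings V n. b \<phi> \<phi>' J}
       \<le> (s ^ card E * s ^ (card E - card J)) *
       (card (embeddings V n) * (card V ^ card V * n ^ (card V - card (\<Union>J))))"
      unfolding a_def b_def
    proof (intro mult_le_mono card_placement_pairs card_embedding_pairs J)
      show "\<Union>J \<subseteq> V" using J graph_edge_subset[OF graph] by blast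
    qed
    finally show ?thesis .
  qed
  have "(\<Sum>x\<in>seqs. \<Sum>i<L. (card (A x i))\<^sup>2) =
      (\<Sum>x\<in>seqs. \<Sum>(w, w')\<in>?W2. of_bool (Q x w w') * card (snd w ` E \<inter> snd w' ` E))"
  proof (intro sum.cong refl)
    fix x
    have "(\<Sum>i<L. (card (A x i))\<^sup>2) =
        (\<Sum>p\<in>?W2. \<Sum>i<L. of_bool (Q x (fst p) (snd p)) * of_bool (i \<in> snd (fst p) ` E \<inter> snd (snd p) ` E))"
      unfolding sq split_beta by (rule sum.swap)
    also have "\<dots> = (\<Sum>p\<in>?W2. of_bool (Q x (fst p) (snd p)) * card (snd (fst p) ` E \<inter> snd (snd p) ` E))"
    proof (intro sum.cong refl)
      fix p assume p: "p \<in> ?W2"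
      have "snd (fst p) ` E \<subseteq> {..<L}" using p placement_less by fastforce
      then have "{..<L} \<inter> (snd (fst p) ` E \<inter> snd (snd p) ` E) = snd (fst p) ` E \<inter> snd (snd p) ` E"
        by blast
      then have "(\<Sum>i<L. of_bool (i \<in> snd (fst p) ` E \<inter> snd (snd p) ` E)) =
          card (snd (fst p) ` E \<inter> snd (snd p) ` E)"
        by (simp only: sum_of_bool_eq finite_lessThan Collect_mem_eq of_nat_id)
      then show "(\<Sum>i<L. of_bool (Q x (fst p) (snd p)) * of_bool (i \<in> snd (fst p) ` E \<inter> snd (snd p) ` E))
        = of_bool (Q x (fst p) (snd p)) * card (snd (fst p) ` E \<inter> snd (snd p) ` E)"
        by (simp only: sum_distrib_left[symmetric])
    qed
    finally show "(\<Sum>i<L. (card (A x i))\<^sup>2) =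
        (\<Sum>(w, w')\<in>?W2. of_bool (Q x w w') * card (snd w ` E \<inter> snd w' ` E))"
      by (simp add: split_beta)
  qed
  also have "\<dots> = (\<Sum>(w, w')\<in>?W2. card {x \<in> seqs. Q x w w'} * card (snd w ` E \<inter> snd w' ` E))"
    unfolding split_beta using finite_seqs
    by (subst sum.swap) (simp add: sum_distrib_right[symmetric] Int_def)
  also have "\<dots> \<le> (\<Sum>(w, w')\<in>?W2. \<Sum>J | J \<subseteq> E \<and> J \<noteq> {}.
      N J * (of_bool (a (snd w) (snd w') J) * of_bool (b (fst w) (fst w') J)))"
    using pair by (intro sum_mono) auto
  also have "\<dots> = (\<Sum>J | J \<subseteq> E \<and> J \<noteq> {}. N J *
      (\<Sum>(w, w')\<in>?W2. of_bool (a (snd w) (snd w') J) * of_bool (b (fst w) (fst w') J)))"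
    unfolding split_beta by (subst sum.swap) (simp only: sum_distrib_left)
  also have "\<dots> \<le> (\<Sum>J | J \<subseteq> E \<and> J \<noteq> {}. N J * ((s ^ card E * s ^ (card E - card J)) *
         (card (embeddings V n) * (card V ^ card V * n ^ (card V - card (\<Union>J))))))"
    using split by (intro sum_mono mult_left_mono) auto
  finally show ?thesis by (simp add: A_def N_def mult.assoc)
qed

section \<open>Comparing the first and the second moment\<close>

lemma card_K_pos: "card K > 0"
  using n2 by (simp add: card_K_edges zero_less_binomial_iff)

lemma K_nonempty [simp]: "K \<noteq> {}"
  using card_K_pos by auto

lemma card_K_le: "real (card K) \<le> real n ^ 2"
proof -
  have "n * (n - 1) div 2 \<le> n * (n - 1)" by (rule div_le_dividend)
  also have "\<dots> \<le> n ^ 2" by (simp add: power2_eq_square)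
  finally have "card K \<le> n ^ 2" by (simp add: card_K_edges choose_two)
  then show ?thesis by (metis of_nat_le_iff of_nat_power)
qed

text \<open>With p for \<open>s / card K\<close>, agreement in \<open>J\<close> divides the term
  without overlap by \<open>n ^ card (\<Union>J) * p ^ card J\<close>, which
  \<open>density_power_ge\<close> bounds below by \<open>s\<close>. The factor
  \<open>2 ^ card E\<close> counts the sets \<open>J\<close>.\<close>

lemma second_moment_le:
  assumes "card E \<ge> 2" "s \<ge> 2" "L = card E * s"
    and p: "real s / real (card K) \<ge> real n powr (- (1 / max_density V E))"
  shows "real (\<Sum>x\<in>seqs. \<Sum>i<L. (card {w \<in> witnesses. shows_copy E w x \<and> i \<in> snd w ` E})\<^sup>2)
    \<le> 2 ^ card E * (real (card E) * real (card V) ^ card V * real (card (embeddings V n)) *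
        real (card K) ^ L * real n ^ card V * (real s / real (card K)) ^ (2 * card E) / real s)"
    (is "_ \<le> 2 ^ card E * ?b")
proof -
  let ?k = "card E" and ?v = "card V" and ?N = "card K" and ?\<Phi> = "card (embeddings V n)"
  let ?p = "real s / real ?N"
  have pos: "real s > 0" "real ?N > 0" "real n > 0" using assms n2 card_K_pos by auto
  define t where "t = (\<lambda>J :: 'a set set. ?k * ?N ^ (L - (2 * ?k - card J)) * (s ^ ?k * s ^ (?k - card J)) *
         (?\<Phi> * (?v ^ ?v * n ^ (?v - card (\<Union>J)))))"
  have t: "real (t J) \<le> ?b" if J: "J \<subseteq> E" "J \<noteq> {}" for J
  proof -
    have j: "card J \<le> ?k" using finE J by (intro card_mono)
    have "\<Union>J \<subseteq> V" using J graph_edge_subset[OF graph] by blast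
    then have w: "card (\<Union>J) \<le> ?v" using finV by (intro card_mono)
    \<comment> \<open>Thanks to \<open>s \<ge> 2\<close> the sequence is long enough for the
      truncated subtraction in the exponent to be a true one.\<close>
    have "2 * ?k \<le> L" using assms(2,3) by simp
    then have "2 * ?k - card J \<le> L" by linarith
    then have 1: "real ?N ^ (L - (2 * ?k - card J)) = real ?N ^ L / (real ?N ^ (2 * ?k) / real ?N ^ card J)"
      using j pos by (simp add: power_diff power_add)
    have 2: "real s ^ ?k * real s ^ (?k - card J) = real s ^ (2 * ?k) / real s ^ card J"
      using j pos by (simp add: power_diff mult_2 power_add)
    have 3: "real n ^ (?v - card (\<Union>J)) = real n ^ ?v / real n ^ card (\<Union>J)"
      using w pos by (simp add: power_diff)
    have "real (t J) = real ?k * real ?N ^ (L - (2 * ?k - card J)) * (real s ^ ?k * real s ^ (?k - card J)) *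
        (real ?\<Phi> * (real ?v ^ ?v * real n ^ (?v - card (\<Union>J))))"
      by (simp add: t_def)
    also have "\<dots> = real ?k * real ?v ^ ?v * real ?\<Phi> * real ?N ^ L * real n ^ ?v *
        ?p ^ (2 * ?k) / (real n ^ card (\<Union>J) * ?p ^ card J)"
      unfolding 1 2 3 using pos by (simp add: power_divide field_simps)
    also have "\<dots> \<le> ?b"
    proof (rule divide_left_mono)
      have "real s = real ?N * ?p" using pos by simp
      also have "\<dots> \<le> real n ^ 2 * ?p" using card_K_le by (intro mult_right_mono) auto
      also have "\<dots> \<le> real n ^ card (\<Union>J) * ?p ^ card J"
        using assms(1) J p n2 by (intro density_power_ge[OF graph]) auto
      finally show "real s \<le> real n ^ card (\<Union>J) * ?p ^ card J" .
      show "0 < real n ^ card (\<Union>J) * ?p ^ card J * real s" using pos by simp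
    qed auto
    finally show ?thesis .
  qed
  have "real (\<Sum>x\<in>seqs. \<Sum>i<L. (card {w \<in> witnesses. shows_copy E w x \<and> i \<in> snd w ` E})\<^sup>2)
      \<le> real (\<Sum>J | J \<subseteq> E \<and> J \<noteq> {}. t J)"
    unfolding t_def of_nat_le_iff by (rule sum_square_copies_at)
  also have "\<dots> = (\<Sum>J | J \<subseteq> E \<and> J \<noteq> {}. real (t J))" by simp
  also have "\<dots> \<le> (\<Sum>J | J \<subseteq> E \<and> J \<noteq> {}. ?b)" using t by (intro sum_mono) auto
  also have "\<dots> \<le> (\<Sum>J \<in> Pow E. ?b)"
    using finE by (intro sum_mono2) auto
  also have "\<dots> = 2 ^ ?k * ?b" using finE by (simp add: card_Pow)
  finally show ?thesis .
qed

text \<open>As Breaker wins, each shown copy has a failed attempt among its positions; the rest is a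
  union bound.\<close>

lemma copies_blocked:
  assumes win: "breaker_winning_strategy V E n q \<sigma>" and x: "x \<in> seqs"
  shows "card {w \<in> witnesses. shows_copy E w x}
    \<le> (\<Sum>i | i < L \<and> x i \<in> breaker_edges (run n \<sigma> x i).
          card {w \<in> witnesses. shows_copy E w x \<and> i \<in> snd w ` E})"
proof -
  let ?D = "{i. i < L \<and> x i \<in> breaker_edges (run n \<sigma> x i)}"
  let ?A = "\<lambda>i. {w \<in> witnesses. shows_copy E w x \<and> i \<in> snd w ` E}"
  have "{w \<in> witnesses. shows_copy E w x} \<subseteq> (\<Union>i\<in>?D. ?A i)"
  proof
    fix w assume w: "w \<in> {w \<in> witnesses. shows_copy E w x}"
    have eq: "(`) (fst w) ` E = x ` snd w ` E"
      using w unfolding image_image by (intro image_cong) (auto simp: shows_copy_def)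
    have "fst w \<in> V \<rightarrow>\<^sub>E {..<n}" "inj_on (fst w) V" using w by (auto simp: embeddings_def)
    then have "(`) (fst w) ` E \<in> copies V E n" unfolding copies_eq[OF graph] by blast
    moreover have L: "snd w ` E \<subseteq> {..<L}" using w placement_less by fastforce
    ultimately obtain i where "i \<in> snd w ` E" "x i \<in> breaker_edges (run n \<sigma> x i)"
      using winning_strategy_blocks[OF win _ _ L eq] copy_edges(1)[OF graph] by blast
    then show "w \<in> (\<Union>i\<in>?D. ?A i)" using w L by blast
  qed
  then have "card {w \<in> witnesses. shows_copy E w x} \<le> card (\<Union>i\<in>?D. ?A i)"
    using finite_embeddings finite_placements by (intro card_mono) auto
  also have "\<dots> \<le> (\<Sum>i\<in>?D. card (?A i))" by (intro card_UN_le) auto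
  finally show ?thesis .
qed

text \<open>All shown copies pass through failed attempts. On average over the sequences, the second
  moment term accounts for at most half of them, so the failures, whose number is bounded in terms
  of \<open>q\<close>, must account for the other half.\<close>

lemma breaker_bias_ge:
  assumes win: "breaker_winning_strategy V E n q \<sigma>"
    and kE: "card E \<ge> 2" and s2: "s \<ge> 2" and L: "L = card E * s" and nv: "n \<ge> 2 * card V"
    and p: "real s / real (card K) \<ge> real n powr (- (1 / max_density V E))"
  shows "real (card K)
    \<le> 2 ^ card E * 2 ^ card V * real (card E) ^ 3 * real (card V) ^ card V * real s * real q"
proof -
  let ?k = "card E" and ?v = "card V" and ?N = "card K" and ?\<Phi> = "card (embeddings V n)"
  define X where "X = (\<lambda>x. card {w \<in> witnesses. shows_copy E w x})"
  define Y where "Y = (\<lambda>x i. card {w \<in> witnesses. shows_copy E w x \<and> i \<in> snd w ` E})"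
  define D where "D = (\<lambda>x. {i. i < L \<and> x i \<in> breaker_edges (run n \<sigma> x i)})"
  define c where "c = 2 ^ ?k * 2 ^ ?v * real ?k * real ?v ^ ?v"
  define r where "r = real s / real ?N"
  \<comment> \<open>\<open>\<mu>\<close> is the mean number of shown witnesses and
    \<open>\<theta>\<close> is of the order of the mean number through one position. The constant
    \<open>c\<close> is chosen to make the second moment at most \<open>\<theta> * \<mu>\<close> on
    average.\<close>
  define \<mu> where "\<mu> = real ?\<Phi> * r ^ ?k"
  define \<theta> where "\<theta> = c * \<mu> / real s"
  have pos: "real s > 0" "real ?N > 0" "real n > 0" using s2 n2 card_K_pos by auto
  have V: "?v > 0"
  proof -
    obtain e where "e \<in> E" using kE by fastforce
    then show ?thesis
      using graph_edge_subset[OF graph] card_graph_edge[OF graph] finV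
      by (metis card_gt_0_iff card_0_eq finite_subset subset_empty zero_neq_numeral)
  qed
  have r0: "r > 0" using pos by (simp add: r_def)
  have nv': "real n ^ ?v \<le> 2 ^ ?v * real ?\<Phi>"
    unfolding embeddings_def by (rule card_embeddings_ge[OF finV nv])
  moreover have "real n ^ ?v > 0" using pos by simp
  ultimately have "2 ^ ?v * real ?\<Phi> > 0" by linarith
  then have "real ?\<Phi> > 0" by (simp add: zero_less_mult_iff)
  then have mu0: "\<mu> > 0" using r0 by (simp add: \<mu>_def)
  have c0: "c > 0" using kE V by (auto simp: c_def)
  have lam0: "\<theta> > 0" using c0 mu0 pos by (simp add: \<theta>_def)
  have kL: "?k \<le> L" "L > 0" using L s2 kE by auto

  have legal: "legal_strategy n q \<sigma>" using win by (simp add: breaker_winning_strategy_def)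
  \<comment> \<open>Used in place of the Cauchy-Schwarz inequality: with a fixed scale
    \<open>\<theta>\<close> the bound is linear in the number of failures and in the squares, so it
    can be summed over the sequences.\<close>
  have amgm: "y \<le> \<theta> / 2 + y\<^sup>2 / (2 * \<theta>)" for y :: real
  proof -
    have "0 \<le> (y - \<theta>)\<^sup>2 / (2 * \<theta>)" using lam0 by simp
    also have "\<dots> = \<theta> / 2 + y\<^sup>2 / (2 * \<theta>) - y"
      using lam0 by (simp add: power2_diff field_simps power2_eq_square)
    finally show ?thesis by simp
  qed
  have X: "real (X x) \<le> \<theta> / 2 * real (card (D x)) + (\<Sum>i<L. (real (Y x i))\<^sup>2) / (2 * \<theta>)"
    if "x \<in> seqs" for x
  proof -
    have "real (X x) \<le> real (\<Sum>i\<in>D x. Y x i)"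
      unfolding of_nat_le_iff X_def Y_def D_def by (rule copies_blocked[OF win that])
    also have "\<dots> \<le> (\<Sum>i\<in>D x. \<theta> / 2 + (real (Y x i))\<^sup>2 / (2 * \<theta>))"
      unfolding of_nat_sum by (intro sum_mono amgm)
    also have "\<dots> = \<theta> / 2 * real (card (D x)) + (\<Sum>i\<in>D x. (real (Y x i))\<^sup>2 / (2 * \<theta>))"
      by (simp add: sum.distrib)
    \<comment> \<open>The set of failures depends on Breaker's strategy; extending the squares to
      all positions removes this dependence.\<close>
    also have "(\<Sum>i\<in>D x. (real (Y x i))\<^sup>2 / (2 * \<theta>)) \<le> (\<Sum>i<L. (real (Y x i))\<^sup>2 / (2 * \<theta>))"
      using lam0 by (intro sum_mono2) (auto simp: D_def)
    finally show ?thesis by (simp add: sum_divide_distrib)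
  qed
  have first: "(\<Sum>x\<in>seqs. real (X x)) = real ?N ^ L * \<mu>"
  proof -
    have "(\<Sum>x\<in>seqs. real (X x)) = real ?\<Phi> * real s ^ ?k * real ?N ^ (L - ?k)"
      using arg_cong[OF sum_card_copies, of real] by (simp add: X_def)
    also have "\<dots> = real ?\<Phi> * real s ^ ?k * (real ?N ^ L / real ?N ^ ?k)"
      using kL pos by (simp add: power_diff[of "real ?N"] del: of_nat_power)
    finally show ?thesis by (simp add: \<mu>_def r_def power_divide)
  qed
  have fail: "(\<Sum>x\<in>seqs. real (card (D x))) \<le> real L * (real q * real L) * (real ?N ^ L / real ?N)"
  proof -
    have "(\<Sum>x\<in>seqs. card (D x)) \<le> L * (q * L) * ?N ^ (L - 1)"
      using sum_card_failures[OF legal, of L] by (simp add: D_def)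
    then have "real (\<Sum>x\<in>seqs. card (D x)) \<le> real (L * (q * L) * ?N ^ (L - 1))"
      by (rule of_nat_mono)
    moreover have "real ?N ^ (L - 1) = real ?N ^ L / real ?N"
      using power_diff[of "real ?N" 1 L] kL(2) pos by simp
    ultimately show ?thesis by simp
  qed
  have second: "(\<Sum>x\<in>seqs. \<Sum>i<L. (real (Y x i))\<^sup>2) \<le> real ?N ^ L * (\<theta> * \<mu>)"
  proof -
    have "(\<Sum>x\<in>seqs. \<Sum>i<L. (real (Y x i))\<^sup>2) \<le> 2 ^ ?k * (real ?k * real ?v ^ ?v * real ?\<Phi> *
        real ?N ^ L * real n ^ ?v * r ^ (2 * ?k) / real s)"
      using second_moment_le[OF kE s2 L p] by (simp add: Y_def r_def)
    also have "\<dots> = (2 ^ ?k * real ?k * real ?v ^ ?v * real ?\<Phi> *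
        real ?N ^ L * r ^ (2 * ?k) / real s) * real n ^ ?v" by simp
    also have "\<dots> \<le> (2 ^ ?k * real ?k * real ?v ^ ?v * real ?\<Phi> *
        real ?N ^ L * r ^ (2 * ?k) / real s) * (2 ^ ?v * real ?\<Phi>)"
      using nv' r0 by (intro mult_left_mono) auto
    also have "\<dots> = real ?N ^ L * (\<theta> * \<mu>)"
      by (simp add: \<theta>_def \<mu>_def c_def mult_2 power_add)
    finally show ?thesis .
  qed
  have "real ?N ^ L * \<mu> \<le> (\<Sum>x\<in>seqs. \<theta> / 2 * real (card (D x)) + (\<Sum>i<L. (real (Y x i))\<^sup>2) / (2 * \<theta>))"
    unfolding first[symmetric] by (intro sum_mono X)
  also have "\<dots> = \<theta> / 2 * (\<Sum>x\<in>seqs. real (card (D x))) + (\<Sum>x\<in>seqs. \<Sum>i<L. (real (Y x i))\<^sup>2) / (2 * \<theta>)"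
    by (simp add: sum.distrib sum_distrib_left sum_divide_distrib)
  also have "\<dots> \<le> \<theta> / 2 * (real L * (real q * real L) * (real ?N ^ L / real ?N)) +
      real ?N ^ L * (\<theta> * \<mu>) / (2 * \<theta>)"
    using lam0 fail second by (intro add_mono mult_left_mono divide_right_mono) auto
  also have "\<dots> = real ?N ^ L * \<mu> * (c * real ?k ^ 2 * real s * real q / (2 * real ?N) + 1 / 2)"
    using c0 mu0 pos by (simp add: \<theta>_def L power2_eq_square field_simps)
  finally have "1 \<le> c * real ?k ^ 2 * real s * real q / (2 * real ?N) + 1 / 2"
    using pos mu0 by (simp add: mult_le_cancel_left1)
  then have "real ?N \<le> c * real ?k ^ 2 * real s * real q"
    using pos by (simp add: field_simps)
  also have "\<dots> = 2 ^ ?k * 2 ^ ?v * real ?k ^ 3 * real ?v ^ ?v * real s * real q"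
    by (simp add: c_def power2_eq_square power3_eq_cube)
  finally show ?thesis .
qed

end

section \<open>Lower bound on the threshold bias\<close>

lemma maker_wins_bound:
  assumes G: "simple_graph V E" and kE: "card E \<ge> 2"
  obtains c where "c > 0"
    "\<And>n q \<sigma>. n \<ge> 2 \<Longrightarrow> n \<ge> 2 * card V \<Longrightarrow> breaker_winning_strategy V E n q \<sigma> \<Longrightarrow>
       c * real n powr (1 / max_density V E) \<le> real q"
proof -
  let ?m = "max_density V E"
  \<comment> \<open>\<open>C - 1\<close> is the constant of \<open>breaker_bias_ge\<close>; the
    added 1 makes \<open>C\<close> positive at once.\<close>
  define C where "C = 2 ^ card E * 2 ^ card V * real (card E) ^ 3 * real (card V) ^ card V + 1"
  have C: "C > 0" unfolding C_def by (intro add_nonneg_pos) auto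
  have m: "?m \<ge> 1 / 2" by (rule max_density_ge_half[OF G kE])
  then have m2: "1 / ?m \<le> 2" by (simp add: pos_divide_le_eq)
  show ?thesis
  proof
    \<comment> \<open>The 12 combines \<open>s \<le> 3 * t\<close> with
      \<open>n ^ 2 \<le> 4 * N\<close>, both shown below.\<close>
    show "1 / (12 * C) > 0" using C by simp
    fix n q \<sigma>
    assume n: "n \<ge> 2" "n \<ge> 2 * card V" and win: "breaker_winning_strategy V E n q \<sigma>"
    define t where "t = real n powr (2 - 1 / ?m)"
    \<comment> \<open>Since \<open>t \<ge> 1\<close>, the extra 1 guarantees
      \<open>s \<ge> 2\<close> and still leaves \<open>s\<close> at most
      \<open>3 * t\<close>.\<close>
    define s where "s = nat \<lceil>t\<rceil> + 1"
    define N where "N = card (K_edges n)"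
    have t: "t \<ge> 1" unfolding t_def using n m2 by (intro ge_one_powr_ge_zero) auto
    have s: "s \<ge> 2" "t \<le> real s" "real s \<le> 3 * t"
      using t unfolding s_def by linarith+
    obtain f where f: "bij_betw f E {..<card E}"
      using ex_bij_betw_finite_nat[OF finite_graph_edges[OF G]] by (auto simp: atLeast0LessThan)
    define P where "P = (\<lambda>e. {f e * s ..< f e * s + s})"
    interpret position_blocks V E n s "card E * s" P
    proof
      show "P e \<subseteq> {..<card E * s}" if "e \<in> E" for e
      proof -
        have "f e < card E" using f that by (auto simp: bij_betw_def)
        then have "Suc (f e) * s \<le> card E * s" by (intro mult_le_mono1) simp
        then show ?thesis by (auto simp: P_def)
      qed
      have "P e \<inter> P e' = {}" if "e \<in> E" "e' \<in> E" "e \<noteq> e'" for e e'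
      proof -
        \<comment> \<open>Integer division by \<open>s\<close> recovers the block of a position, so
          distinct blocks are disjoint.\<close>
        have div: "i div s = f e" if "i \<in> P e" for i e
          using that s(1) by (auto simp: P_def mult.commute intro!: div_nat_eqI)
        have "f e \<noteq> f e'" using f that by (auto simp: bij_betw_def inj_on_def)
        then show ?thesis using div by (metis disjoint_iff)
      qed
      then show "disjoint_family_on P E" by (auto simp: disjoint_family_on_def)
    qed (use G n in \<open>auto simp: P_def\<close>)
    have N: "N > 0" "real N \<le> real n ^ 2" using card_K_pos card_K_le by (auto simp: N_def)
    have tn: "t * real n powr (1 / ?m) = real n ^ 2"
    proof -
      have "t * real n powr (1 / ?m) = real n powr 2" by (simp add: t_def flip: powr_add)
      then show ?thesis using n by simp
    qed
    have "real n powr (- (1 / ?m)) = t / real n ^ 2"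
      using n t by (simp add: tn[symmetric] powr_minus field_simps)
    also have "\<dots> \<le> real s / real N" using s t N by (intro frac_le) auto
    finally have "real N \<le> (C - 1) * real s * real q"
      unfolding C_def N_def using breaker_bias_ge[OF win kE s(1) refl n(2)] by simp
    also have "\<dots> \<le> C * (3 * t) * real q"
      using s C by (intro mult_right_mono mult_mono) auto
    finally have 1: "real N \<le> 3 * C * t * real q" by simp
    have "real N = real n * (real n - 1) / 2"
      using n by (simp add: N_def card_K_edges choose_two real_of_nat_div of_nat_diff)
    moreover have "real n * 2 \<le> real n * real n" using n(1) by (intro mult_left_mono) auto
    ultimately have "real n ^ 2 \<le> 4 * real N" by (simp add: power2_eq_square algebra_simps)
    with 1 have "t * real n powr (1 / ?m) \<le> t * (12 * C * real q)"
      unfolding tn by (simp add: algebra_simps)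
    then have "real n powr (1 / ?m) \<le> 12 * C * real q" using t by simp
    then show "1 / (12 * C) * real n powr (1 / ?m) \<le> real q" using C by (simp add: field_simps)
  qed
qed

theorem proposition1p7:
  fixes V :: "'a set" and E :: "'a set set"
  assumes "simple_graph V E"
    and "card E \<ge> 2"
  shows "(\<lambda>n. real (threshold_bias V E n)) \<in> \<Theta>[at_top](\<lambda>n. real n powr (1 / max_density V E))"
proof -
  let ?g = "\<lambda>n. real n powr (1 / max_density V E)"
  obtain C where C: "C > 0"
    and breaker: "\<And>n q. n > 0 \<Longrightarrow> real q \<ge> C * ?g n \<Longrightarrow> \<exists>\<sigma>. breaker_winning_strategy V E n q \<sigma>"
    using breaker_wins_bound[OF assms] by blast
  obtain c where c: "c > 0"
    and maker: "\<And>n q \<sigma>. n \<ge> 2 \<Longrightarrow> n \<ge> 2 * card V \<Longrightarrow> breaker_winning_strategy V E n q \<sigma> \<Longrightarrow>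
       c * ?g n \<le> real q"
    using maker_wins_bound[OF assms] by blast
  have bounds: "c * ?g n \<le> real (threshold_bias V E n) \<and> real (threshold_bias V E n) \<le> (C + 1) * ?g n"
    if n: "n \<ge> 2 + 2 * card V" for n
  proof -
    let ?q = "nat \<lceil>C * ?g n\<rceil>"
    have win: "\<exists>\<sigma>. breaker_winning_strategy V E n ?q \<sigma>"
      using n by (intro breaker) (auto simp: real_nat_ceiling_ge)
    then have "\<exists>\<sigma>. breaker_winning_strategy V E n (threshold_bias V E n) \<sigma>"
      unfolding threshold_bias_def by (rule LeastI)
    then have "c * ?g n \<le> real (threshold_bias V E n)" using n maker[of n] by auto
    moreover have "threshold_bias V E n \<le> ?q"
      unfolding threshold_bias_def using win by (rule Least_le)
    \<comment> \<open>Rounding up costs at most 1, which \<open>?g n \<ge> 1\<close> absorbs; hence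
      the constant \<open>C + 1\<close>.\<close>
    moreover have "real ?q \<le> C * ?g n + 1"
      using C by (simp add: of_nat_nat)
    moreover have "1 \<le> ?g n"
      using n max_density_ge_half[OF assms] by (intro ge_one_powr_ge_zero) auto
    ultimately show ?thesis by (auto simp: algebra_simps)
  qed
  have ev: "eventually (\<lambda>n. n \<ge> 2 + 2 * card V) at_top" by (rule eventually_ge_at_top)
  show ?thesis
  proof (rule bigthetaI)
    show "(\<lambda>n. real (threshold_bias V E n)) \<in> O(?g)"
      by (intro bigoI[where c = "C + 1"] eventually_mono[OF ev]) (use bounds in auto)
    show "(\<lambda>n. real (threshold_bias V E n)) \<in> \<Omega>(?g)"
      by (intro landau_omega.bigI[where c = c] eventually_mono[OF ev] c) (use bounds in auto)
  qed
qed

end
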